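(* Let $(a_j)_{j\ge1}$ be a sequence of nonnegative integers and suppose there are constants $r>0$, $y\ge1$, $D_1,D_2>0$ with $D_1 j^{r-1}y^j\le a_j\le D_2 j^{r-1}y^j$ for all $j\ge1$. Then the class of multisets with parameters $(a_j)$ has a monadic second order logical limit law.
   Context: A multiset with parameters $(a_j)$ is a finite unordered collection (repetitions allowed) of indecomposable components, where there are exactly $a_j$ distinct component types of size $j$; its size is the sum of the sizes of its components. Multisets are regarded as finite (unlabelled) relational structures whose connected components are the components, and $c_n$ denotes the number of multisets of size $n$, so that $\sum_{n\ge0}c_nx^n=\prod_{j\ge1}(1-x^j)^{-a_j}$. The class has a monadic second order logical limit law if, for every sentence $\varphi$ of monadic second order logic, the proportion of the $c_n$ multisets of size $n$ satisfying $\varphi$ (i.e. the probability that a uniformly random multiset of size $n$ satisfies $\varphi$) converges as $n\to\infty$. *)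

theory Defs
  imports Complex_Main "HOL-Library.Multiset"
begin

text \<open>The relation symbols are the elements of the type \<open>'r\<close>; the signature is completed by an
  arity function \<open>ar\<close>, which is an argument of the definitions below that depend on it.\<close>

record ('r, 'v) rel_struct =
  univ :: "'v set"
  rel :: "'r \<Rightarrow> 'v list set"

definition finite_struct :: "('r \<Rightarrow> nat) \<Rightarrow> ('r, 'v) rel_struct \<Rightarrow> bool" where
  "finite_struct ar S \<longleftrightarrow>
     finite (univ S) \<and> (\<forall>R. \<forall>t\<in>rel S R. length t = ar R \<and> set t \<subseteq> univ S)"

definition struct_iso :: "('r, 'v) rel_struct \<Rightarrow> ('r, 'w) rel_struct \<Rightarrow> bool" where
  "struct_iso S T \<longleftrightarrow>
     (\<exists>f. bij_betw f (univ S) (univ T) \<and>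
          (\<forall>R. \<forall>t\<in>lists (univ S). t \<in> rel S R \<longleftrightarrow> map f t \<in> rel T R))"

text \<open>Connectedness of a structure is connectedness of its Gaifman graph, in which two elements
  are joined if they occur in a common tuple of some relation.\<close>

definition gaifman :: "('r, 'v) rel_struct \<Rightarrow> ('v \<times> 'v) set" where
  "gaifman S = {(x, y). \<exists>R. \<exists>t\<in>rel S R. x \<in> set t \<and> y \<in> set t}"

definition connected_struct :: "('r, 'v) rel_struct \<Rightarrow> bool" where
  "connected_struct S \<longleftrightarrow> univ S \<noteq> {} \<and> (\<forall>x\<in>univ S. \<forall>y\<in>univ S. (x, y) \<in> (gaifman S)\<^sup>*)"

text \<open>A set \<open>C\<close> of structures contains one representative of each component type, and there are
  exactly \<open>a j\<close> types of size \<open>j\<close>. Relation symbols have positive arity because a nullary relation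
  is not determined by the components of a structure.\<close>

definition component_types ::
  "('r \<Rightarrow> nat) \<Rightarrow> ('r, 'v) rel_struct set \<Rightarrow> (nat \<Rightarrow> nat) \<Rightarrow> bool" where
  "component_types ar C a \<longleftrightarrow>
     (\<forall>R. ar R > 0) \<and>
     (\<forall>S\<in>C. finite_struct ar S \<and> connected_struct S) \<and>
     pairwise (\<lambda>S T. \<not> struct_iso S T) C \<and>
     (\<forall>j\<ge>1. finite {S\<in>C. card (univ S) = j} \<and> card {S\<in>C. card (univ S) = j} = a j)"

definition multisets_of_size ::
  "('r, 'v) rel_struct set \<Rightarrow> nat \<Rightarrow> ('r, 'v) rel_struct multiset set" where
  "multisets_of_size C n = {M. set_mset M \<subseteq> C \<and> (\<Sum>S\<in>#M. card (univ S)) = n}"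

text \<open>The structure given by a multiset is the disjoint union of its members with multiplicity;
  \<open>(S, i, v)\<close> is the element \<open>v\<close> of the \<open>i\<close>-th copy of \<open>S\<close>.\<close>

definition disjoint_union ::
  "('r, 'v) rel_struct multiset \<Rightarrow> ('r, ('r, 'v) rel_struct \<times> nat \<times> 'v) rel_struct" where
  "disjoint_union M =
     \<lparr>univ = {(S, i, v) | S i v. i < count M S \<and> v \<in> univ S},
      rel = (\<lambda>R. {map (\<lambda>v. (S, i, v)) t | S i t. i < count M S \<and> t \<in> rel S R})\<rparr>"

text \<open>Element variables and set variables are both named by natural numbers, but they form
  separate name spaces.\<close>

datatype 'r mso =
    Rel 'r "nat list"
  | Eq nat nat
  | Mem nat nat \<comment> \<open>element variable, set variable\<close>
  | Neg "'r mso"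
  | Conj "'r mso" "'r mso"
  | ExElem nat "'r mso"
  | ExSet nat "'r mso"

primrec mso_formula :: "('r \<Rightarrow> nat) \<Rightarrow> 'r mso \<Rightarrow> bool" where
  "mso_formula ar (Rel R xs) \<longleftrightarrow> length xs = ar R"
| "mso_formula ar (Eq x y) \<longleftrightarrow> True"
| "mso_formula ar (Mem x X) \<longleftrightarrow> True"
| "mso_formula ar (Neg p) \<longleftrightarrow> mso_formula ar p"
| "mso_formula ar (Conj p q) \<longleftrightarrow> mso_formula ar p \<and> mso_formula ar q"
| "mso_formula ar (ExElem x p) \<longleftrightarrow> mso_formula ar p"
| "mso_formula ar (ExSet X p) \<longleftrightarrow> mso_formula ar p"

primrec free_elem :: "'r mso \<Rightarrow> nat set" where
  "free_elem (Rel R xs) = set xs"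
| "free_elem (Eq x y) = {x, y}"
| "free_elem (Mem x X) = {x}"
| "free_elem (Neg p) = free_elem p"
| "free_elem (Conj p q) = free_elem p \<union> free_elem q"
| "free_elem (ExElem x p) = free_elem p - {x}"
| "free_elem (ExSet X p) = free_elem p"

primrec free_set :: "'r mso \<Rightarrow> nat set" where
  "free_set (Rel R xs) = {}"
| "free_set (Eq x y) = {}"
| "free_set (Mem x X) = {X}"
| "free_set (Neg p) = free_set p"
| "free_set (Conj p q) = free_set p \<union> free_set q"
| "free_set (ExElem x p) = free_set p"
| "free_set (ExSet X p) = free_set p - {X}"

definition mso_sentence :: "('r \<Rightarrow> nat) \<Rightarrow> 'r mso \<Rightarrow> bool" where
  "mso_sentence ar p \<longleftrightarrow> mso_formula ar p \<and> free_elem p = {} \<and> free_set p = {}"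

primrec sat ::
  "('r, 'v) rel_struct \<Rightarrow> (nat \<Rightarrow> 'v) \<Rightarrow> (nat \<Rightarrow> 'v set) \<Rightarrow> 'r mso \<Rightarrow> bool" where
  "sat S e E (Rel R xs) \<longleftrightarrow> map e xs \<in> rel S R"
| "sat S e E (Eq x y) \<longleftrightarrow> e x = e y"
| "sat S e E (Mem x X) \<longleftrightarrow> e x \<in> E X"
| "sat S e E (Neg p) \<longleftrightarrow> \<not> sat S e E p"
| "sat S e E (Conj p q) \<longleftrightarrow> sat S e E p \<and> sat S e E q"
| "sat S e E (ExElem x p) \<longleftrightarrow> (\<exists>v\<in>univ S. sat S (e(x := v)) E p)"
| "sat S e E (ExSet X p) \<longleftrightarrow> (\<exists>V. V \<subseteq> univ S \<and> sat S e (E(X := V)) p)"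

text \<open>For a sentence the assignments are irrelevant.\<close>

definition models :: "('r, 'v) rel_struct \<Rightarrow> 'r mso \<Rightarrow> bool" where
  "models S p \<longleftrightarrow> (\<forall>e E. sat S e E p)"

definition mso_limit_law :: "('r \<Rightarrow> nat) \<Rightarrow> ('r, 'v) rel_struct set \<Rightarrow> bool" where
  "mso_limit_law ar C \<longleftrightarrow>
     (\<forall>p. mso_sentence ar p \<longrightarrow>
        convergent (\<lambda>n. real (card {M \<in> multisets_of_size C n. models (disjoint_union M) p})
                        / real (card (multisets_of_size C n))))"

end

theory Submission
  imports Defs "HOL-Library.Nat_Bijection"
    "HOL-Computational_Algebra.Formal_Power_Series"
begin

text \<open>
  Logic: by induction on the formula, in the manner of Feferman and Vaught, the truth of a sentence
  in a disjoint union depends only on finitely many types of components, the number of components of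
  each type being counted up to a threshold. A set quantifier replaces types by sets of types; by
  the pigeonhole principle the threshold grows by a factor of the number of types.

  Analysis: \<open>h n = c n / y ^ n\<close> satisfies \<open>n h(n) = (\<Sum>k\<le>n. w(k) h(n - k))\<close>, where \<open>w(k)\<close>
  is \<open>y ^ (- k)\<close> times the sum of \<open>d a(d)\<close> over the divisors \<open>d\<close> of \<open>k\<close>; \<open>w\<close> tends to infinity and is
  negligible against its partial sums. Dividing the generating function by a power of \<open>1 - X / 2\<close>
  only changes \<open>h\<close> by a factor with a positive limit and achieves \<open>w(k) \<ge> 1\<close> for all \<open>k \<ge> 1\<close>. Then
  the differences \<open>g\<close> of \<open>h\<close> are nonnegative, since they satisfy the recurrence with weights
  \<open>w(k) - 1\<close>, and comparing the two recurrences gives \<open>g(n) = o(h(n))\<close>. Hence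
  \<open>c(n) / c(n + 1)\<close> tends to \<open>1 / y\<close>, and \<open>c(m) \<le> K y ^ (m - n) c(n)\<close> for \<open>m \<le> n\<close>.

  Densities: events that depend on finitely many components have densities. Let \<open>P\<close> be a set of
  components. If the sum of \<open>y ^ (- size)\<close> over \<open>P\<close> is finite, then with high probability only finitely
  many members of \<open>P\<close> matter; if it is infinite, then any fixed number of components from \<open>P\<close> is
  exceeded with probability tending to 1.
\<close>

section \<open>Threshold properties of multisets\<close>

text \<open>Counts matter only up to the threshold \<open>t\<close>. The one-step form, adding a
  single further copy, is what the constructions below verify; \<open>stable_capped\<close> derives
  the global form.\<close>

definition stable :: "'a set \<Rightarrow> nat \<Rightarrow> ('a multiset \<Rightarrow> bool) \<Rightarrow> bool" where
  "stable A t g \<longleftrightarrow>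
     (\<forall>M \<alpha>. set_mset M \<subseteq> A \<longrightarrow> count M \<alpha> \<ge> t \<longrightarrow> \<alpha> \<in> A \<longrightarrow> g (add_mset \<alpha> M) = g M)"

lemma stableD:
  "stable A t g \<Longrightarrow> set_mset M \<subseteq> A \<Longrightarrow> count M \<alpha> \<ge> t \<Longrightarrow> \<alpha> \<in> A \<Longrightarrow> g (add_mset \<alpha> M) = g M"
  by (simp add: stable_def)

text \<open>Surplus copies are removed one at a time: if \<alpha> occurs more than \<open>t\<close>
  times, at least \<open>t\<close> copies remain after one removal, so stability applies.\<close>

lemma stable_truncate:
  assumes g: "stable A t g" and "set_mset M \<subseteq> A"
  shows "\<exists>M'. set_mset M' \<subseteq> A \<and> g M' = g M \<and> (\<forall>\<alpha>. count M' \<alpha> = min t (count M \<alpha>))"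
  using assms(2)
proof (induction "size M" arbitrary: M rule: less_induct)
  case less
  show ?case
  proof (cases "\<exists>\<alpha>. count M \<alpha> > t")
    case True
    then obtain \<alpha> where big: "count M \<alpha> > t" by blast
    then have "\<alpha> \<in># M" by (metis count_inI not_less0)
    then obtain M1 where M1: "M = add_mset \<alpha> M1" by (metis multi_member_split)
    have "g M = g M1"
      unfolding M1 using less.prems big M1 by (intro stableD[OF g]) auto
    moreover have "min t (count M1 \<beta>) = min t (count M \<beta>)" for \<beta>
      using big M1 by auto
    moreover have "\<exists>M'. set_mset M' \<subseteq> A \<and> g M' = g M1 \<and> (\<forall>\<alpha>. count M' \<alpha> = min t (count M1 \<alpha>))"
      using less.prems by (intro less.hyps) (auto simp: M1)
    ultimately show ?thesis by simp
  next
    case False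
    then show ?thesis
      using less.prems by (intro exI[of _ M]) (auto simp: not_less min_absorb2)
  qed
qed

text \<open>Truncating both multisets yields the same multiset. Hence, over a finite
  \<open>A\<close>, only finitely many vectors of capped counts have to be distinguished.\<close>

lemma stable_capped:
  assumes g: "stable A t g"
    and "set_mset M \<subseteq> A" and "set_mset N \<subseteq> A"
    and "\<And>\<alpha>. \<alpha> \<in> A \<Longrightarrow> min t (count M \<alpha>) = min t (count N \<alpha>)"
  shows "g M = g N"
proof -
  obtain M' N' where *: "g M' = g M" "\<And>\<alpha>. count M' \<alpha> = min t (count M \<alpha>)"
    "g N' = g N" "\<And>\<alpha>. count N' \<alpha> = min t (count N \<alpha>)"
    using stable_truncate[OF g assms(2)] stable_truncate[OF g assms(3)] by blast
  have "count M' \<alpha> = count N' \<alpha>" for \<alpha>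
  proof (cases "\<alpha> \<in> A")
    case False
    then have "count M \<alpha> = 0" "count N \<alpha> = 0"
      using assms(2,3) by (auto simp: count_eq_zero_iff)
    then show ?thesis by (simp add: *)
  qed (simp add: * assms(4))
  then have "M' = N'" by (simp add: multiset_eq_iff)
  then show ?thesis using * by simp
qed

lemma stable_neg: "stable A t g \<Longrightarrow> stable A t (\<lambda>M. \<not> g M)"
  by (simp add: stable_def)

lemma count_image_mset_ge: "count M x \<le> count (image_mset f M) (f x)"
  by (induction M) auto

lemma stable_image:
  assumes "stable A t g" and "f ` B \<subseteq> A"
  shows "stable B t (\<lambda>M. g (image_mset f M))"
  unfolding stable_def
proof (intro allI impI)
  fix M \<alpha> assume "set_mset M \<subseteq> B" "t \<le> count M \<alpha>" "\<alpha> \<in> B"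
  then show "g (image_mset f (add_mset \<alpha> M)) = g (image_mset f M)"
    using assms(2) order.trans[OF _ count_image_mset_ge[of M \<alpha> f]]
    by (simp, intro stableD[OF assms(1)]) (auto simp: image_subset_iff subset_iff)
qed

lemma stable_conj:
  assumes "stable A t g" and "stable A t' g'"
  shows "stable A (max t t') (\<lambda>M. g M \<and> g' M)"
  using assms unfolding stable_def by simp

section \<open>Matchings between multisets\<close>

lemma rel_mset_obtain_pairs:
  assumes "rel_mset R M N"
  obtains P where "M = image_mset fst P" "N = image_mset snd P"
    "\<And>b x. (b, x) \<in># P \<Longrightarrow> R b x"
  using assms by (auto simp: multiset.in_rel subset_iff)

lemma rel_mset_pairsI:
  "(\<And>b x. (b, x) \<in># P \<Longrightarrow> R b x) \<Longrightarrow> rel_mset R (image_mset fst P) (image_mset snd P)"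
  by (auto simp: multiset.in_rel subset_iff)

text \<open>The partners of the more than \<open>t * card A\<close> copies of \<open>b\<close> lie
  in \<open>A\<close>, so some pair \<open>(b, x)\<close> occurs more than \<open>t\<close> times in
  the matching. Deleting one such pair leaves a matching.\<close>

lemma rel_mset_pigeonhole:
  assumes "rel_mset (\<lambda>b x. x \<in> F b) M N" and "finite A" and "F b \<subseteq> A"
    and "count M b > t * card A"
  obtains x where "x \<in> F b" and "count N x > t"
    and "rel_mset (\<lambda>b x. x \<in> F b) (M - {#b#}) (N - {#x#})"
proof -
  obtain P where P: "M = image_mset fst P" "N = image_mset snd P"
    and mem: "\<And>b x. (b, x) \<in># P \<Longrightarrow> x \<in> F b"
    using rel_mset_obtain_pairs[OF assms(1)] by metis
  have "\<exists>x. count P (b, x) > t"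
  proof (rule ccontr)
    assume "\<not> ?thesis"
    then have le: "count P (b, x) \<le> t" for x by (simp add: not_less)
    have fin: "finite (Pair b ` A)" using assms(2) by simp
    have "count M b = (\<Sum>p\<in>fst -` {b} \<inter> set_mset P. count P p)"
      by (simp add: P count_image_mset)
    also have "\<dots> \<le> (\<Sum>p\<in>Pair b ` A. count P p)"
    proof (rule sum_mono2[OF fin])
      show "fst -` {b} \<inter> set_mset P \<subseteq> Pair b ` A"
        using mem assms(3) by (force simp: image_iff)
    qed simp
    also have "\<dots> = (\<Sum>x\<in>A. count P (b, x))"
      by (subst sum.reindex) (auto intro: inj_onI)
    also have "\<dots> \<le> t * card A"
      using sum_bounded_above[of A "\<lambda>x. count P (b, x)" t] le by (simp add: mult.commute)
    finally show False using assms(4) by simp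
  qed
  then obtain x where x: "count P (b, x) > t" by blast
  then have xP: "(b, x) \<in># P" by (metis count_inI not_less0)
  show thesis
  proof (rule that)
    show "x \<in> F b" using mem xP .
    show "count N x > t"
      using x count_image_mset_ge[of P "(b, x)" snd] by (simp add: P)
    have "image_mset fst (P - {#(b, x)#}) = M - {#b#}" "image_mset snd (P - {#(b, x)#}) = N - {#x#}"
      using xP by (simp_all add: P image_mset_Diff)
    moreover have "rel_mset (\<lambda>b x. x \<in> F b) (image_mset fst (P - {#(b, x)#}))
        (image_mset snd (P - {#(b, x)#}))"
      using mem by (intro rel_mset_pairsI) (meson in_diffD)
    ultimately show "rel_mset (\<lambda>b x. x \<in> F b) (M - {#b#}) (N - {#x#})"
      by simp
  qed
qed

text \<open>This is the effect of a set quantifier: each component offers a set \<open>F b\<close>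
  of attainable types, from which one is picked. If \<open>b\<close> is frequent, some pick
  \<open>x\<close> for it occurs more than \<open>t\<close> times in \<open>N\<close>, and one pair
  \<open>(b, x)\<close> can be added or removed without affecting \<open>g\<close>.\<close>

lemma stable_ex:
  assumes g: "stable A t g" and A: "finite A" and F: "\<And>b. b \<in> B \<Longrightarrow> F b \<subseteq> A"
  shows "stable B (t * card A + 1) (\<lambda>M. \<exists>N. rel_mset (\<lambda>b x. x \<in> F b) M N \<and> g N)"
  unfolding stable_def
proof (intro allI impI)
  fix M b assume M: "set_mset M \<subseteq> B" "t * card A + 1 \<le> count M b" "b \<in> B"
  have sub: "set_mset N \<subseteq> A" if r: "rel_mset (\<lambda>b x. x \<in> F b) M' N" and "set_mset M' \<subseteq> B" for M' N
  proof -
    obtain P where "M' = image_mset fst P" "N = image_mset snd P" "\<And>b x. (b, x) \<in># P \<Longrightarrow> x \<in> F b"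
      using rel_mset_obtain_pairs[OF r] by metis
    then show ?thesis using that(2) F by fastforce
  qed
  show "(\<exists>N. rel_mset (\<lambda>b x. x \<in> F b) (add_mset b M) N \<and> g N) =
        (\<exists>N. rel_mset (\<lambda>b x. x \<in> F b) M N \<and> g N)"
  proof
    assume "\<exists>N. rel_mset (\<lambda>b x. x \<in> F b) (add_mset b M) N \<and> g N"
    then obtain N where N: "rel_mset (\<lambda>b x. x \<in> F b) (add_mset b M) N" "g N" by blast
    obtain x where x: "x \<in> F b" "count N x > t"
      "rel_mset (\<lambda>b x. x \<in> F b) (add_mset b M - {#b#}) (N - {#x#})"
      using rel_mset_pigeonhole[OF N(1) A F[OF M(3)], of t] M(2) by auto
    have "x \<in># N" using x(2) by (metis count_inI not_less0)
    \<comment> \<open>More than \<open>t\<close> copies of \<open>x\<close> in \<open>N\<close>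
      leave at least \<open>t\<close> after the removal, as stability requires.\<close>
    then have "g (N - {#x#}) = g (add_mset x (N - {#x#}))"
      using sub[OF N(1)] M x F[OF M(3)] by (intro stableD[OF g, symmetric]) (auto dest: in_diffD)
    then have "g (N - {#x#})" using \<open>x \<in># N\<close> N(2) by simp
    then show "\<exists>N. rel_mset (\<lambda>b x. x \<in> F b) M N \<and> g N" using x(3) by auto
  next
    assume "\<exists>N. rel_mset (\<lambda>b x. x \<in> F b) M N \<and> g N"
    then obtain N where N: "rel_mset (\<lambda>b x. x \<in> F b) M N" "g N" by blast
    obtain x where x: "x \<in> F b" "count N x > t"
      using rel_mset_pigeonhole[OF N(1) A F[OF M(3)], of t] M(2) by auto
    have "g (add_mset x N) = g N"
      using sub[OF N(1)] M x F[OF M(3)] by (intro stableD[OF g]) auto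
    moreover have "rel_mset (\<lambda>b x. x \<in> F b) (add_mset b M) (add_mset x N)"
      using rel_mset_Plus[of "\<lambda>b x. x \<in> F b" b x M N] x N by simp
    ultimately show "\<exists>N. rel_mset (\<lambda>b x. x \<in> F b) (add_mset b M) N \<and> g N"
      using N(2) by blast
  qed
qed

text \<open>Turns a matching into a choice function on the index set, the form in which
  component-wise choices of subsets appear in \<open>decomposable_ex\<close>.\<close>

lemma rel_mset_image_mset_set:
  assumes "finite I"
  shows "rel_mset R (image_mset f (mset_set I)) N \<longleftrightarrow>
    (\<exists>h. N = image_mset h (mset_set I) \<and> (\<forall>i\<in>I. R (f i) (h i)))"
  using assms
proof (induction I arbitrary: N)
  case empty
  show ?case by (auto simp: rel_mset_def)
next
  case (insert i I)
  show ?case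
  proof
    assume "rel_mset R (image_mset f (mset_set (insert i I))) N"
    then have "rel_mset R (add_mset (f i) (image_mset f (mset_set I))) N"
      using insert.hyps by simp
    from msed_rel_invL[OF this] obtain N1 x where N: "N = add_mset x N1" "R (f i) x"
      "rel_mset R (image_mset f (mset_set I)) N1" by auto
    then obtain h where h: "N1 = image_mset h (mset_set I)" "\<forall>i\<in>I. R (f i) (h i)"
      using insert.IH by blast
    have "image_mset (h(i := x)) (mset_set I) = image_mset h (mset_set I)"
      using insert.hyps by (intro image_mset_cong) auto
    then show "\<exists>h. N = image_mset h (mset_set (insert i I)) \<and> (\<forall>i\<in>insert i I. R (f i) (h i))"
      using N h insert.hyps by (intro exI[of _ "h(i := x)"]) auto
  next
    assume "\<exists>h. N = image_mset h (mset_set (insert i I)) \<and> (\<forall>i\<in>insert i I. R (f i) (h i))"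
    then obtain h where h: "N = image_mset h (mset_set (insert i I))" "\<forall>i\<in>insert i I. R (f i) (h i)"
      by blast
    then have "rel_mset R (image_mset f (mset_set I)) (image_mset h (mset_set I))"
      using insert.IH by auto
    then show "rel_mset R (image_mset f (mset_set (insert i I))) N"
      using h insert.hyps rel_mset_Plus[of R "f i" "h i"] by simp
  qed
qed

section \<open>Sentences on disjoint unions\<close>

definition copies :: "'s multiset \<Rightarrow> ('s \<times> nat) set" where
  "copies M = {(S, i). i < count M S}"

text \<open>The trace of an assignment on one component, moved into the component itself so that
  copies of one structure with equal traces are indistinguishable.\<close>

definition restr :: "('x \<Rightarrow> ('s \<times> nat \<times> 'v) set) \<Rightarrow> 's \<times> nat \<Rightarrow> 'x \<Rightarrow> 'v set" where
  "restr E = (\<lambda>(S, i) x. {v. (S, i, v) \<in> E x})"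

lemma finite_copies: "finite (copies M)"
proof -
  have "copies M = (SIGMA S:set_mset M. {..<count M S})"
    by (auto simp: copies_def) (metis count_inI not_less0)
  then show ?thesis by simp
qed

lemma image_fst_copies: "image_mset fst (mset_set (copies M)) = M"
proof (rule multiset_eqI)
  fix S
  have "count (image_mset fst (mset_set (copies M))) S = card (fst -` {S} \<inter> copies M)"
    by (simp add: count_image_mset finite_copies)
  also have "fst -` {S} \<inter> copies M = Pair S ` {..<count M S}"
    by (auto simp: copies_def)
  finally show "count (image_mset fst (mset_set (copies M))) S = count M S"
    by (simp add: card_image inj_on_def)
qed

text \<open>The composition property of Feferman and Vaught: \<open>P\<close> is a threshold
  property of the multiset of types of the components. Types are natural numbers, so that pairs and
  finite sets of types can be encoded as types again.\<close>

definition decomposable ::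
  "('s multiset \<Rightarrow> ('x \<Rightarrow> ('s \<times> nat \<times> 'v) set) \<Rightarrow> bool) \<Rightarrow> bool" where
  "decomposable P \<longleftrightarrow> (\<exists>(A :: nat set) t \<tau> g. finite A \<and> stable A t g \<and> (\<forall>S E. \<tau> S E \<in> A) \<and>
     (\<forall>M E. P M E \<longleftrightarrow> g (image_mset (\<lambda>c. \<tau> (fst c) (restr E c)) (mset_set (copies M)))))"

lemma decomposable_neg:
  fixes P :: "'s multiset \<Rightarrow> ('x \<Rightarrow> ('s \<times> nat \<times> 'v) set) \<Rightarrow> bool"
  assumes "decomposable P"
  shows "decomposable (\<lambda>M E. \<not> P M E)"
proof -
  obtain A t g and \<tau> :: "'s \<Rightarrow> ('x \<Rightarrow> 'v set) \<Rightarrow> nat"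
    where "finite A" "stable A t g" "\<forall>S E. \<tau> S E \<in> A"
      "\<forall>M E. P M E \<longleftrightarrow> g (image_mset (\<lambda>c. \<tau> (fst c) (restr E c)) (mset_set (copies M)))"
    using assms unfolding decomposable_def by blast
  then show ?thesis
    unfolding decomposable_def
    by (intro exI[of _ A] exI[of _ t] exI[of _ \<tau>] exI[of _ "\<lambda>M. \<not> g M"]) (simp add: stable_neg)
qed

text \<open>The type of a component is the encoded pair of its two types, and the projections
  recover both multisets of types.\<close>

lemma decomposable_conj:
  fixes P :: "'s multiset \<Rightarrow> ('x \<Rightarrow> ('s \<times> nat \<times> 'v) set) \<Rightarrow> bool"
  assumes "decomposable P" and "decomposable Q"
  shows "decomposable (\<lambda>M E. P M E \<and> Q M E)"
proof -
  obtain A t g and \<tau> :: "'s \<Rightarrow> ('x \<Rightarrow> 'v set) \<Rightarrow> nat"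
    where P: "finite A" "stable A t g" "\<forall>S E. \<tau> S E \<in> A"
      "\<forall>M E. P M E \<longleftrightarrow> g (image_mset (\<lambda>c. \<tau> (fst c) (restr E c)) (mset_set (copies M)))"
    using assms(1) unfolding decomposable_def by blast
  obtain B u h and \<sigma> :: "'s \<Rightarrow> ('x \<Rightarrow> 'v set) \<Rightarrow> nat"
    where Q: "finite B" "stable B u h" "\<forall>S E. \<sigma> S E \<in> B"
      "\<forall>M E. Q M E \<longleftrightarrow> h (image_mset (\<lambda>c. \<sigma> (fst c) (restr E c)) (mset_set (copies M)))"
    using assms(2) unfolding decomposable_def by blast
  define p1 p2 where "p1 = (\<lambda>k. fst (prod_decode k))" and "p2 = (\<lambda>k. snd (prod_decode k))"
  define D where "D = prod_encode ` (A \<times> B)"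
  have p: "p1 ` D \<subseteq> A" "p2 ` D \<subseteq> B"
    by (auto simp: p1_def p2_def D_def)
  have "stable D (max t u) (\<lambda>M. g (image_mset p1 M) \<and> h (image_mset p2 M))"
    by (rule stable_conj[OF stable_image[OF P(2) p(1)] stable_image[OF Q(2) p(2)]])
  moreover have "finite D" using P(1) Q(1) by (simp add: D_def)
  ultimately show ?thesis
    unfolding decomposable_def
    using P(3,4) Q(3,4)
    by (intro exI[of _ D] exI[of _ "max t u"] exI[of _ "\<lambda>S E. prod_encode (\<tau> S E, \<sigma> S E)"]
        exI[of _ "\<lambda>M. g (image_mset p1 M) \<and> h (image_mset p2 M)"])
      (simp add: D_def p1_def p2_def multiset.map_comp o_def)
qed

lemma bex_iff_one_mem:
  assumes "finite K"
  shows "(\<exists>c\<in>K. R c) \<longleftrightarrow> 1 \<in># image_mset (\<lambda>c. of_bool (R c) :: nat) (mset_set K)"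
proof -
  have "(\<exists>c\<in>K. R c) \<longleftrightarrow> (\<exists>c\<in>K. 1 = (of_bool (R c) :: nat))"
    by (rule bex_cong) auto
  then show ?thesis
    using assms by (simp only: set_image_mset finite_set_mset_mset_set image_iff)
qed

text \<open>The type records whether \<open>Q\<close> holds in the component; existence means that
  type 1 occurs, which is a property with threshold 1.\<close>

lemma decomposable_atom:
  "decomposable (\<lambda>M E. \<exists>c\<in>copies M. Q (fst c) (restr E c))"
proof -
  have "stable {0, 1 :: nat} 1 (\<lambda>M. 1 \<in># M)"
    by (auto simp: stable_def count_inI)
  moreover have "(\<exists>c\<in>copies M. Q (fst c) (restr E c)) \<longleftrightarrow>
      1 \<in># image_mset (\<lambda>c. of_bool (Q (fst c) (restr E c)) :: nat) (mset_set (copies M))" for M and E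
    by (rule bex_iff_one_mem[OF finite_copies])
  ultimately show ?thesis
    unfolding decomposable_def
    by (intro exI[of _ "{0, 1}"] exI[of _ 1] exI[of _ "\<lambda>S E. of_bool (Q S E)"]
        exI[of _ "\<lambda>M. 1 \<in># M"]) simp
qed

lemma count_image_mset_set:
  assumes "finite K"
  shows "count (image_mset f (mset_set K)) j = card {c \<in> K. f c = j}"
proof -
  have "f -` {j} \<inter> K = {c \<in> K. f c = j}" by auto
  then show ?thesis using assms by (simp add: count_image_mset)
qed

text \<open>Traces that are empty, singletons or larger get the types 0, 2 and 3. There is exactly
  one point iff type 2 occurs once and type 3 never, and threshold 2 tells one occurrence from
  several. Points of \<open>E x\<close> outside the components are left out because the traces do
  not see them.\<close>

lemma decomposable_singleton:
  "decomposable (\<lambda>(M :: 's multiset) (E :: 'x \<Rightarrow> ('s \<times> nat \<times> 'v) set). \<exists>!p. p \<in> E x \<and> (fst p, fst (snd p)) \<in> copies M)"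
proof -
  define k :: "'v set \<Rightarrow> nat" where "k V = (if V = {} then 0 else if \<exists>v. V = {v} then 2 else 3)" for V
  define g where "g = (\<lambda>M. count M (2::nat) = 1 \<and> count M 3 = 0)"
  have "stable {0, 2, 3} 2 g"
    by (auto simp: stable_def g_def count_inI)
  moreover have "(\<exists>!p. p \<in> E x \<and> (fst p, fst (snd p)) \<in> copies M) \<longleftrightarrow>
      g (image_mset (\<lambda>c. k (restr E c x)) (mset_set (copies M)))" (is "?L \<longleftrightarrow> ?R")
    for M :: "'s multiset" and E :: "'x \<Rightarrow> _"
  proof -
    let ?K = "\<lambda>j. {c \<in> copies M. k (restr E c x) = j}"
    have cnt: "count (image_mset (\<lambda>c. k (restr E c x)) (mset_set (copies M))) j = card (?K j)" for j
      by (rule count_image_mset_set[OF finite_copies])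
    have k1: "k V = 2 \<longleftrightarrow> (\<exists>v. V = {v})" and k2: "k V = 3 \<longleftrightarrow> V \<noteq> {} \<and> (\<nexists>v. V = {v})" for V
      by (auto simp: k_def)
    have R: "?R \<longleftrightarrow> (\<exists>c. ?K 2 = {c}) \<and> ?K 3 = {}"
      unfolding g_def cnt using finite_copies[of M] by (simp add: card_1_singleton_iff)
    show ?thesis
    proof
      assume ?L
      then obtain p where p: "p \<in> E x \<and> (fst p, fst (snd p)) \<in> copies M"
        "\<forall>q. q \<in> E x \<and> (fst q, fst (snd q)) \<in> copies M \<longrightarrow> q = p"
        by (rule ex1E)
      obtain S i v where p': "p = (S, i, v)" by (cases p)
      have v: "(S, i) \<in> copies M"
        and uniq: "(T, j) \<in> copies M \<Longrightarrow> (T, j, w) \<in> E x \<longleftrightarrow> (T, j, w) = (S, i, v)" for T j w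
        using p(1) p(2)[rule_format, of "(T, j, w)"] by (auto simp: p')
      have one: "restr E (S, i) x = {v}" using v by (simp add: restr_def uniq)
      have zero: "restr E c x = {}" if "c \<in> copies M" "c \<noteq> (S, i)" for c
        using that by (cases c) (auto simp: restr_def uniq)
      have "c \<in> ?K 2 \<longleftrightarrow> c = (S, i)" "c \<notin> ?K 3" for c
        using one zero[of c] v k1[of "restr E c x"] k2[of "restr E c x"]
        by (cases "c = (S, i)"; simp)+
      then have "?K 2 = {(S, i)}" "?K 3 = {}" by blast+
      then show ?R using R by blast
    next
      assume ?R
      then obtain c where c: "?K 2 = {c}" "?K 3 = {}" using R by blast
      then have "c \<in> ?K 2" by blast
      then obtain v where v: "c \<in> copies M" "restr E c x = {v}" by (auto simp: k1)
      obtain S i where Si: "c = (S, i)" by (cases c)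
      show ?L
      proof (rule ex1I)
        show "(S, i, v) \<in> E x \<and> (fst (S, i, v), fst (snd (S, i, v))) \<in> copies M"
          using v Si by (auto simp: restr_def)
      next
        fix p assume p: "p \<in> E x \<and> (fst p, fst (snd p)) \<in> copies M"
        obtain T j w where pT: "p = (T, j, w)" by (cases p)
        have "w \<in> restr E (T, j) x" "(T, j) \<in> copies M" using p pT by (auto simp: restr_def)
        then have "(T, j) \<in> ?K 2" using c(2) by (auto simp: k1 k2)
        then have "(T, j) = (S, i)" using c(1) Si by blast
        then show "p = (S, i, v)" using v Si p pT by (auto simp: restr_def)
      qed
    qed
  qed
  moreover have "k V \<in> {0, 2, 3}" for V by (simp add: k_def)
  ultimately show ?thesis
    unfolding decomposable_def
    by (intro exI[of _ "{0, 2, 3}"] exI[of _ 2] exI[of _ "\<lambda>S E. k (E x)"] exI[of _ g]) simp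
qed

text \<open>A subset of the disjoint union is an independent choice of a subset in each component.
  So the new type of a component is the encoded set of old types that it attains as \<open>x\<close>
  varies, and \<open>stable_ex\<close> applies.\<close>

lemma decomposable_ex:
  fixes P :: "'s multiset \<Rightarrow> ('x \<Rightarrow> ('s \<times> nat \<times> 'v) set) \<Rightarrow> bool"
  assumes "decomposable P"
  shows "decomposable (\<lambda>M E. \<exists>V \<subseteq> {(S, i, v). (S, i) \<in> copies M \<and> v \<in> U S}. P M (E(x := V)))"
proof -
  obtain A t g and \<tau> :: "'s \<Rightarrow> ('x \<Rightarrow> 'v set) \<Rightarrow> nat"
    where P: "finite A" "stable A t g" "\<And>S E. \<tau> S E \<in> A"
      "\<And>M E. P M E \<longleftrightarrow> g (image_mset (\<lambda>c. \<tau> (fst c) (restr E c)) (mset_set (copies M)))"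
    using assms unfolding decomposable_def by blast
  define types where "types S E = {\<tau> S (E(x := V)) | V. V \<subseteq> U S}" for S E
  have types: "types S E \<subseteq> A" for S E using P(3) by (auto simp: types_def)
  have decode: "set_decode (set_encode (types S E)) = types S E" for S E
    using finite_subset[OF types P(1)] by simp
  define B where "B = set_encode ` Pow A"
  define h where "h = (\<lambda>M. \<exists>N. rel_mset (\<lambda>b y. y \<in> set_decode b) M N \<and> g N)"
  have B: "set_decode b \<subseteq> A" if "b \<in> B" for b
    using that finite_subset[OF _ P(1)] by (auto simp: B_def)
  have "(\<exists>V \<subseteq> {(S, i, v). (S, i) \<in> copies M \<and> v \<in> U S}. P M (E(x := V))) \<longleftrightarrow>
      h (image_mset (\<lambda>c. set_encode (types (fst c) (restr E c))) (mset_set (copies M)))"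
    (is "?L \<longleftrightarrow> ?R") for M and E :: "'x \<Rightarrow> ('s \<times> nat \<times> 'v) set"
  proof
    assume ?L
    then obtain V where V: "V \<subseteq> {(S, i, v). (S, i) \<in> copies M \<and> v \<in> U S}" "P M (E(x := V))" by blast
    \<comment> \<open>The trace of \<open>V\<close> alone on the component \<open>c\<close>,
      obtained by viewing \<open>V\<close> as an assignment to a single dummy variable.\<close>
    define W where "W c = restr (\<lambda>_::unit. V) c ()" for c
    have W: "restr (E(x := V)) c = (restr E c)(x := W c)" for c
      by (rule ext) (auto simp: restr_def W_def split: prod.splits)
    have "W c \<subseteq> U (fst c)" for c
      using V(1) by (cases c) (auto simp: W_def restr_def )
    then have "\<tau> (fst c) (restr (E(x := V)) c) \<in> types (fst c) (restr E c)" for c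
      unfolding types_def W by blast
    then show ?R
      unfolding h_def rel_mset_image_mset_set[OF finite_copies] decode
      using V(2)[unfolded P(4)] by (intro exI conjI[rotated]) auto
  next
    assume ?R
    then obtain f where f: "g (image_mset f (mset_set (copies M)))"
      "\<And>c. c \<in> copies M \<Longrightarrow> f c \<in> types (fst c) (restr E c)"
      unfolding h_def rel_mset_image_mset_set[OF finite_copies] decode by blast
    have "\<forall>c\<in>copies M. \<exists>V. V \<subseteq> U (fst c) \<and> f c = \<tau> (fst c) ((restr E c)(x := V))"
      using f(2) unfolding types_def by blast
    then obtain W where W: "\<And>c. c \<in> copies M \<Longrightarrow> W c \<subseteq> U (fst c)"
      "\<And>c. c \<in> copies M \<Longrightarrow> f c = \<tau> (fst c) ((restr E c)(x := W c))"
      by metis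
    \<comment> \<open>The chosen subsets of the components are glued together.\<close>
    define V where "V = {(S, i, v). (S, i) \<in> copies M \<and> v \<in> W (S, i)}"
    have "restr (E(x := V)) c = (restr E c)(x := W c)" if "c \<in> copies M" for c
      using that by (intro ext) (auto simp: restr_def V_def split: prod.splits)
    then have "image_mset (\<lambda>c. \<tau> (fst c) (restr (E(x := V)) c)) (mset_set (copies M)) =
        image_mset f (mset_set (copies M))"
      using W(2) by (intro image_mset_cong) (simp add: finite_copies)
    then have "P M (E(x := V))" using f(1) P(4) by simp
    moreover have "V \<subseteq> {(S, i, v). (S, i) \<in> copies M \<and> v \<in> U S}"
      using W(1) by (fastforce simp: V_def)
    ultimately show ?L by blast
  qed
  moreover have "stable B (t * card A + 1) h"
    unfolding h_def by (rule stable_ex[OF P(2,1) B])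
  moreover have "finite B" using P(1) by (simp add: B_def)
  moreover have "set_encode (types S E) \<in> B" for S E
    using types by (simp add: B_def)
  ultimately show ?thesis
    unfolding decomposable_def
    by (intro exI[of _ B] exI[of _ "t * card A + 1"] exI[of _ "\<lambda>S E. set_encode (types S E)"]
        exI[of _ h]) simp
qed

section \<open>Translation of formulas into component-wise conditions\<close>

lemma univ_disjoint_union: "univ (disjoint_union M) = {(S, i, v). (S, i) \<in> copies M \<and> v \<in> univ S}"
  by (auto simp: disjoint_union_def copies_def)

lemma copies_Int_iff:
  assumes "p \<in> {(S, i, v). (S, i) \<in> copies M \<and> v \<in> U S}" and "E x = {p}"
  shows "(\<exists>c\<in>copies M. restr E c x \<inter> restr E c z \<noteq> {}) \<longleftrightarrow> p \<in> E z"
proof -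
  obtain S i v where p: "p = (S, i, v)" by (cases p)
  have *: "restr E c x = (if c = (S, i) then {v} else {})" for c
    using assms(2) by (cases c) (auto simp: restr_def p)
  have "(S, i) \<in> copies M" using assms(1) by (simp add: p)
  then have "(\<exists>c\<in>copies M. restr E c x \<inter> restr E c z \<noteq> {}) \<longleftrightarrow> v \<in> restr E (S, i) z"
    unfolding * by auto
  then show ?thesis by (simp add: restr_def p)
qed

text \<open>An element variable \<open>x\<close> is turned into the set variable \<open>Inl x\<close>, to be assigned a singleton,
  so that atomic formulas only look at single components.\<close>

primrec sem :: "'r mso \<Rightarrow> ('r, 'v) rel_struct multiset \<Rightarrow>
    (nat + nat \<Rightarrow> (('r, 'v) rel_struct \<times> nat \<times> 'v) set) \<Rightarrow> bool" where
  "sem (Rel R xs) M E \<longleftrightarrow>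
     (\<exists>c\<in>copies M. \<exists>t\<in>rel (fst c) R. list_all2 (\<lambda>v x. v \<in> restr E c (Inl x)) t xs)"
| "sem (Eq x y) M E \<longleftrightarrow> (\<exists>c\<in>copies M. restr E c (Inl x) \<inter> restr E c (Inl y) \<noteq> {})"
| "sem (Mem x X) M E \<longleftrightarrow> (\<exists>c\<in>copies M. restr E c (Inl x) \<inter> restr E c (Inr X) \<noteq> {})"
| "sem (Neg p) M E \<longleftrightarrow> \<not> sem p M E"
| "sem (Conj p q) M E \<longleftrightarrow> sem p M E \<and> sem q M E"
| "sem (ExElem x p) M E \<longleftrightarrow> (\<exists>V\<subseteq>univ (disjoint_union M).
     (\<exists>!p. p \<in> (E(Inl x := V)) (Inl x) \<and> (fst p, fst (snd p)) \<in> copies M) \<and> sem p M (E(Inl x := V)))"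
| "sem (ExSet X p) M E \<longleftrightarrow> (\<exists>V\<subseteq>univ (disjoint_union M). sem p M (E(Inr X := V)))"

lemma decomposable_sem: "decomposable (sem p)"
proof (induction p)
  case (Rel R xs)
  show ?case
    using decomposable_atom[of "\<lambda>S E. \<exists>t\<in>rel S R. list_all2 (\<lambda>v x. v \<in> E (Inl x)) t xs"]
    by simp
next
  case (Eq x y)
  show ?case using decomposable_atom[of "\<lambda>S E. E (Inl x) \<inter> E (Inl y) \<noteq> {}"] by simp
next
  case (Mem x X)
  show ?case using decomposable_atom[of "\<lambda>S E. E (Inl x) \<inter> E (Inr X) \<noteq> {}"] by simp
next
  case (Neg p)
  then show ?case using decomposable_neg[of "sem p"] by simp
next
  case (Conj p q)
  then show ?case using decomposable_conj[of "sem p" "sem q"] by simp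
next
  case (ExElem x p)
  then show ?case
    using decomposable_ex[OF decomposable_conj[OF decomposable_singleton[of "Inl x"]], of "sem p" univ "Inl x"]
    by (simp add: univ_disjoint_union)
next
  case (ExSet X p)
  then show ?case using decomposable_ex[of "sem p" univ "Inr X"] by (simp add: univ_disjoint_union)
qed

text \<open>A tuple of a relation lies inside one copy, so an atom is witnessed by a single
  component. The conditions concern free variables only; thus a quantifier can be treated by
  updating one variable, and a sentence puts no condition on the assignments.\<close>

lemma sat_disjoint_union:
  assumes "\<And>x. x \<in> free_elem p \<Longrightarrow> e x \<in> univ (disjoint_union M) \<and> E' (Inl x) = {e x}"
    and "\<And>X. X \<in> free_set p \<Longrightarrow> E' (Inr X) = E X"
  shows "sat (disjoint_union M) e E p \<longleftrightarrow> sem p M E'"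
  using assms
proof (induction p arbitrary: e E E')
  case (Rel R xs)
  have e: "E' (Inl x) = {e x}" if "x \<in> set xs" for x using Rel that by simp
  show ?case
  proof
    assume "sat (disjoint_union M) e E (Rel R xs)"
    then obtain S i t where t: "map e xs = map (\<lambda>v. (S, i, v)) t" "i < count M S" "t \<in> rel S R"
      by (auto simp: disjoint_union_def)
    have "list_all2 (\<lambda>v x. v \<in> restr E' (S, i) (Inl x)) t xs"
      unfolding list_all2_conv_all_nth
    proof (intro conjI allI impI)
      show len: "length t = length xs" using arg_cong[OF t(1), of length] by simp
      fix k assume k: "k < length t"
      then have "e (xs ! k) = (S, i, t ! k)"
        using arg_cong[OF t(1), of "\<lambda>l. l ! k"] len by simp
      then show "t ! k \<in> restr E' (S, i) (Inl (xs ! k))"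
        using e[of "xs ! k"] k len by (simp add: restr_def)
    qed
    then show "sem (Rel R xs) M E'"
      using t(2,3) unfolding sem.simps copies_def
      by (intro bexI[of _ "(S, i)"] bexI[of _ t]) simp_all
  next
    assume "sem (Rel R xs) M E'"
    then obtain S i t where t: "i < count M S" "t \<in> rel S R"
      "list_all2 (\<lambda>v x. v \<in> restr E' (S, i) (Inl x)) t xs"
      by (auto simp: copies_def)
    have "map e xs = map (\<lambda>v. (S, i, v)) t"
    proof (rule nth_equalityI)
      show len: "length (map e xs) = length (map (\<lambda>v. (S, i, v)) t)"
        using list_all2_lengthD[OF t(3)] by simp
      fix k assume "k < length (map e xs)"
      then show "map e xs ! k = map (\<lambda>v. (S, i, v)) t ! k"
        using list_all2_nthD2[OF t(3), of k] e[of "xs ! k"] len by (simp add: restr_def)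
    qed
    then show "sat (disjoint_union M) e E (Rel R xs)"
      using t by (auto simp: disjoint_union_def)
  qed
next
  case (Eq x y)
  then show ?case
    using copies_Int_iff[of "e x" M univ E' "Inl x" "Inl y"] by (simp add: univ_disjoint_union)
next
  case (Mem x X)
  then show ?case
    using copies_Int_iff[of "e x" M univ E' "Inl x" "Inr X"] by (simp add: univ_disjoint_union)
next
  case (Neg p)
  then show ?case by simp
next
  case (Conj p q)
  have "sat (disjoint_union M) e E p \<longleftrightarrow> sem p M E'"
    using Conj.prems by (intro Conj.IH) auto
  moreover have "sat (disjoint_union M) e E q \<longleftrightarrow> sem q M E'"
    using Conj.prems by (intro Conj.IH) auto
  ultimately show ?case by simp
next
  case (ExElem x p)
  have IH: "sat (disjoint_union M) (e(x := v)) E p \<longleftrightarrow> sem p M (E'(Inl x := {v}))"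
    if "v \<in> univ (disjoint_union M)" for v
    using ExElem.prems that by (intro ExElem.IH) auto
  \<comment> \<open>All points of a subset of the universe lie in components, so the uniqueness
    clause of \<open>sem\<close> just says that \<open>V\<close> is a singleton.\<close>
  have single: "(\<exists>!p. p \<in> V \<and> (fst p, fst (snd p)) \<in> copies M) \<longleftrightarrow> (\<exists>v. V = {v})"
    if "V \<subseteq> univ (disjoint_union M)" for V
  proof -
    have "p \<in> V \<Longrightarrow> (fst p, fst (snd p)) \<in> copies M" for p
      using that by (auto simp: univ_disjoint_union)
    then have "p \<in> V \<and> (fst p, fst (snd p)) \<in> copies M \<longleftrightarrow> p \<in> V" for p
      by blast
    then show ?thesis by (simp only:) blast
  qed
  have "sem (ExElem x p) M E' \<longleftrightarrow>
      (\<exists>V\<subseteq>univ (disjoint_union M). (\<exists>v. V = {v}) \<and> sem p M (E'(Inl x := V)))"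
    by (simp only: sem.simps fun_upd_same single cong: conj_cong)
  also have "\<dots> \<longleftrightarrow> (\<exists>v\<in>univ (disjoint_union M). sem p M (E'(Inl x := {v})))"
    by auto
  also have "\<dots> \<longleftrightarrow> sat (disjoint_union M) e E (ExElem x p)"
    using IH by simp
  finally show ?case ..
next
  case (ExSet X p)
  have "sat (disjoint_union M) e (E(X := V)) p \<longleftrightarrow> sem p M (E'(Inr X := V))" for V
    using ExSet.prems by (intro ExSet.IH) auto
  then show ?case by simp
qed

text \<open>A sentence can be evaluated under the assignment that is empty everywhere. All traces
  are then empty, and the type of a component depends on its structure alone.\<close>

theorem models_disjoint_union:
  fixes p :: "'r mso"
  assumes "mso_sentence ar p"
  obtains A :: "nat set" and t g and \<tau> :: "('r, 'v) rel_struct \<Rightarrow> nat"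
  where "finite A" and "stable A t g" and "\<And>S. \<tau> S \<in> A"
    and "\<And>M. models (disjoint_union M) p \<longleftrightarrow> g (image_mset \<tau> M)"
proof -
  obtain A t g and \<tau> :: "('r, 'v) rel_struct \<Rightarrow> (nat + nat \<Rightarrow> 'v set) \<Rightarrow> nat"
    where P: "finite A" "stable A t g" "\<And>S E. \<tau> S E \<in> A"
      "\<And>M E. sem p M E \<longleftrightarrow> g (image_mset (\<lambda>c. \<tau> (fst c) (restr E c)) (mset_set (copies M)))"
    using decomposable_sem[of p] unfolding decomposable_def by blast
  have "models (disjoint_union M) p \<longleftrightarrow> g (image_mset (\<lambda>S. \<tau> S (\<lambda>_. {})) M)" for M
  proof -
    have "models (disjoint_union M) p \<longleftrightarrow> sem p M (\<lambda>_. {})"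
      unfolding models_def
      using sat_disjoint_union[of p _ M "\<lambda>_. {}"] assms by (simp add: mso_sentence_def)
    also have "\<dots> \<longleftrightarrow> g (image_mset (\<lambda>c. \<tau> (fst c) (\<lambda>_. {})) (mset_set (copies M)))"
      by (simp add: P(4) restr_def split_def)
    also have "image_mset (\<lambda>c. \<tau> (fst c) (\<lambda>_. {})) (mset_set (copies M)) =
        image_mset (\<lambda>S. \<tau> S (\<lambda>_. {})) (image_mset fst (mset_set (copies M)))"
      by (simp add: multiset.map_comp o_def)
    finally show ?thesis by (simp add: image_fst_copies)
  qed
  then show thesis
    using that[OF P(1,2), of "\<lambda>S. \<tau> S (\<lambda>_. {})"] P(3) by blast
qed

section \<open>Coefficients of series with given logarithmic derivative\<close>

unbundle fps_syntax

text \<open>The equation \<open>fps_X * fps_deriv F = W * F\<close> says that \<open>W\<close> is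
  the logarithmic derivative x F' / F, which turns products into sums.\<close>

lemma fps_X_deriv_mult:
  fixes F1 F2 :: "'a::comm_ring_1 fps"
  assumes "fps_X * fps_deriv F1 = W1 * F1" and "fps_X * fps_deriv F2 = W2 * F2"
  shows "fps_X * fps_deriv (F1 * F2) = (W1 + W2) * (F1 * F2)"
proof -
  have "fps_X * fps_deriv (F1 * F2) =
      (fps_X * fps_deriv F1) * F2 + F1 * (fps_X * fps_deriv F2)"
    by (simp add: algebra_simps)
  then show ?thesis
    by (simp only: assms) (simp add: algebra_simps)
qed

lemma fps_X_deriv_power:
  fixes F :: "'a::comm_ring_1 fps"
  assumes "fps_X * fps_deriv F = W * F"
  shows "fps_X * fps_deriv (F ^ s) = (of_nat s * W) * F ^ s"
proof (induction s)
  case (Suc s)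
  show ?case
    using fps_X_deriv_mult[OF assms Suc.IH] by (simp add: algebra_simps)
qed simp

text \<open>The logarithmic derivative is - q x / (1 - q x), expanded as a geometric series.\<close>

lemma fps_X_deriv_one_minus:
  fixes q :: "'a::field_char_0"
  shows "fps_X * fps_deriv (1 - fps_const q * fps_X) =
    Abs_fps (\<lambda>k. if k = 0 then 0 else - (q ^ k)) * (1 - fps_const q * fps_X)"
proof (rule fps_ext)
  fix n
  define Z where "Z = Abs_fps (\<lambda>k. if k = 0 then 0 else - (q ^ k))"
  have Z: "Z $ k = (if k = 0 then 0 else - (q ^ k))" for k
    by (simp add: Z_def)
  have "Z * (1 - fps_const q * fps_X) = Z - fps_const q * (fps_X * Z)"
    by (simp add: algebra_simps)
  then have "(Z * (1 - fps_const q * fps_X)) $ n = (if n = 1 then - q else 0)"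
    by (cases n) (auto simp: Z)
  moreover have "(fps_X * fps_deriv (1 - fps_const q * fps_X)) $ n = (if n = 1 then - q else 0)"
    by (simp add: fps_X_def[symmetric])
  ultimately show "(fps_X * fps_deriv (1 - fps_const q * fps_X)) $ n =
    (Abs_fps (\<lambda>k. if k = 0 then 0 else - (q ^ k)) * (1 - fps_const q * fps_X)) $ n"
    by (simp add: Z_def)
qed

text \<open>Obtained by differentiating \<open>F * I = 1\<close>.\<close>

lemma fps_X_deriv_inverse:
  fixes F :: "'a::field_char_0 fps"
  assumes "fps_X * fps_deriv F = W * F" and "F $ 0 \<noteq> 0"
  shows "fps_X * fps_deriv (inverse F) = (- W) * inverse F"
proof -
  define I where "I = inverse F"
  have FI: "F * I = 1"
    using assms(2) by (simp add: I_def inverse_mult_eq_1')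
  have "fps_deriv (F * I) = 0"
    by (simp add: FI)
  then have *: "F * fps_deriv I = - (fps_deriv F * I)"
    by (simp add: eq_neg_iff_add_eq_0 add.commute)
  have "fps_X * fps_deriv I = (F * I) * (fps_X * fps_deriv I)"
    by (simp add: FI)
  also have "\<dots> = fps_X * I * (F * fps_deriv I)"
    by (simp only: mult_ac)
  also have "\<dots> = - ((fps_X * fps_deriv F) * I * I)"
    by (simp only: *) (simp add: mult_ac)
  also have "\<dots> = - (W * (F * I) * I)"
    by (simp only: assms(1)) (simp add: mult_ac)
  finally show ?thesis
    using FI by (simp add: I_def)
qed

section \<open>From logarithmic derivatives to coefficient ratios\<close>

lemma fps_X_deriv_nth:
  fixes F :: "'a::comm_ring_1 fps"
  assumes "fps_X * fps_deriv F = W * F"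
  shows "of_nat n * F $ n = (\<Sum>i=0..n. W $ i * F $ (n - i))"
proof -
  have "(fps_X * fps_deriv F) $ n = of_nat n * F $ n"
    by (cases n) auto
  then show ?thesis
    using assms by (simp add: fps_mult_nth)
qed

text \<open>One factor replaces the coefficient at n + 1 by itself minus \<open>q\<close> times its
  predecessor; as consecutive values of \<open>b\<close> are asymptotically equal, the limit is
  multiplied by \<open>1 - q\<close>.\<close>

lemma ratio_limit_one_minus_power:
  fixes F :: "real fps"
  assumes lim: "(\<lambda>n. F $ n / b n) \<longlonglongrightarrow> l"
    and b: "\<And>n. b n \<noteq> 0" and rat: "(\<lambda>n. b n / b (Suc n)) \<longlonglongrightarrow> 1"
  shows "(\<lambda>n. ((1 - fps_const q * fps_X) ^ s * F) $ n / b n) \<longlonglongrightarrow> (1 - q) ^ s * l"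
proof (induction s)
  case 0
  show ?case using lim by simp
next
  case (Suc s)
  define P where "P = (1 - fps_const q * fps_X) ^ s * F"
  have "(\<lambda>n. P $ Suc n / b (Suc n) - q * ((P $ n / b n) * (b n / b (Suc n))))
      \<longlonglongrightarrow> (1 - q) ^ s * l - q * (((1 - q) ^ s * l) * 1)"
    by (intro tendsto_intros rat LIMSEQ_Suc[OF Suc.IH[folded P_def]] Suc.IH[folded P_def])
  moreover have "P $ Suc n / b (Suc n) - q * ((P $ n / b n) * (b n / b (Suc n)))
      = ((1 - fps_const q * fps_X) * P) $ Suc n / b (Suc n)" for n
    using b by (simp add: algebra_simps diff_divide_distrib)
  ultimately have "(\<lambda>n. ((1 - fps_const q * fps_X) * P) $ Suc n / b (Suc n))
      \<longlonglongrightarrow> (1 - q) ^ Suc s * l"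
    by (simp add: algebra_simps)
  then show ?case
    by (simp add: P_def mult.assoc filterlim_sequentially_Suc[of "\<lambda>n. _ n / b n"])
qed

text \<open>The differences \<open>G\<close> of \<open>H\<close> have logarithmic derivative
  \<open>U\<close>, which is \<open>W\<close> minus 1 from index 1 on and hence nonnegative; so
  \<open>G\<close> is nonnegative and \<open>H\<close> increases. Smallness of \<open>W\<close>
  against its partial sums makes \<open>G\<close> negligible against \<open>H\<close>.\<close>

lemma log_deriv_ratio_ge_one:
  fixes H W :: "real fps"
  assumes XH: "fps_X * fps_deriv H = W * H" and H0: "H $ 0 = 1"
    and W0: "W $ 0 = 0" and W1: "\<And>k. k \<ge> 1 \<Longrightarrow> W $ k \<ge> 1"
    and small: "\<And>e. e > 0 \<Longrightarrow> \<exists>B. \<forall>k. W $ k \<le> e * (\<Sum>i\<le>k. W $ i) + B"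
  shows "mono (\<lambda>n. H $ n)" and "\<And>n. H $ n \<ge> 1"
    and "(\<lambda>n. H $ n / H $ Suc n) \<longlonglongrightarrow> 1"
proof -
  define G where "G = (1 - fps_X) * H"
  define U where "U = W + Abs_fps (\<lambda>k. if k = 0 then 0 else - 1)"
  have XG: "fps_X * fps_deriv G = U * G"
    using fps_X_deriv_mult[OF fps_X_deriv_one_minus[of 1] XH]
    unfolding G_def U_def by (simp only: power_one fps_const_1_eq_1 mult_1 add.commute)
  have G0: "G $ 0 = 1"
    by (simp add: G_def H0)
  have U0: "U $ 0 = 0" and U: "k \<ge> 1 \<Longrightarrow> U $ k = W $ k - 1" for k
    using W0 by (auto simp: U_def)
  have Unn: "U $ k \<ge> 0" for k
    using U0 U[of k] W1[of k] by (cases "k = 0") auto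
  have UW: "U $ k \<le> W $ k" for k
    using U0 U[of k] W0 by (cases "k = 0") auto
  have Wnn: "W $ k \<ge> 0" for k
    using W0 W1[of k] by (cases "k = 0") auto
  have Gnn: "G $ n \<ge> 0" for n
  proof (induction n rule: less_induct)
    case (less n)
    show ?case
    proof (cases "n = 0")
      case False
      have "U $ i * G $ (n - i) \<ge> 0" if "i \<le> n" for i
        using U0 Unn[of i] less[of "n - i"] False that by (cases "i = 0") auto
      then have "real n * G $ n \<ge> 0"
        using fps_X_deriv_nth[OF XG, of n] by (auto intro!: sum_nonneg)
      then show ?thesis
        using False by (simp add: zero_le_mult_iff)
    qed (simp add: G0)
  qed
  have HG: "H $ Suc n = H $ n + G $ Suc n" for n
    by (simp add: G_def algebra_simps)
  show mono: "mono (\<lambda>n. H $ n)"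
    by (rule incseq_SucI) (simp add: HG Gnn) 
  show H1: "H $ n \<ge> 1" for n
    using monoD[OF mono, of 0 n] H0 by simp
  have Hsum: "H $ n = (\<Sum>m\<le>n. G $ m)" for n
    by (induction n) (auto simp: HG H0 G0)
  \<comment> \<open>Writing \<open>H\<close> as partial sums of \<open>G\<close> and exchanging
    summations gives a sum over the \<open>G m\<close>, in which partial sums of \<open>W\<close>
    stand where the recurrence of \<open>G\<close> has single weights \<open>U\<close>. The two can
    then be compared term by term.\<close>
  have nH: "real n * H $ n = (\<Sum>m\<le>n. (\<Sum>i\<le>n - m. W $ i) * G $ m)" for n
  proof -
    have "real n * H $ n = (\<Sum>i\<le>n. W $ i * (\<Sum>m\<le>n - i. G $ m))"
      using fps_X_deriv_nth[OF XH, of n] by (simp add: Hsum atMost_atLeast0)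
    also have "\<dots> = (\<Sum>(i, m)\<in>(SIGMA i:{..n}. {..n - i}). W $ i * G $ m)"
      by (simp add: sum_distrib_left sum.Sigma)
    also have "\<dots> = (\<Sum>(m, i)\<in>(SIGMA m:{..n}. {..n - m}). W $ i * G $ m)"
      by (rule sum.reindex_bij_witness[of _ "\<lambda>(a, b). (b, a)" "\<lambda>(a, b). (b, a)"]) auto
    also have "\<dots> = (\<Sum>m\<le>n. (\<Sum>i\<le>n - m. W $ i) * G $ m)"
      by (simp add: sum_distrib_right sum.Sigma)
    finally show ?thesis .
  qed
  have "(\<lambda>n. G $ n / H $ n) \<longlonglongrightarrow> 0"
  proof (rule LIMSEQ_I)
    fix e :: real assume e: "e > 0"
    obtain B where B: "\<And>k. W $ k \<le> e / 2 * (\<Sum>i\<le>k. W $ i) + B"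
      using small[of "e / 2"] e by auto
    have B0: "B \<ge> 0" using B[of 0] W0 by simp
    have key: "real n * G $ n \<le> (e / 2 * real n + B) * H $ n" for n
    proof -
      have "real n * G $ n = (\<Sum>i=0..n. U $ i * G $ (n - i))"
        by (rule fps_X_deriv_nth[OF XG])
      also have "\<dots> = (\<Sum>m\<le>n. U $ (n - m) * G $ m)"
        by (rule sum.reindex_bij_witness[of _ "\<lambda>m. n - m" "\<lambda>m. n - m"]) auto
      also have "\<dots> \<le> (\<Sum>m\<le>n. (e / 2 * (\<Sum>i\<le>n - m. W $ i) + B) * G $ m)"
        by (intro sum_mono mult_right_mono Gnn order.trans[OF UW B])
      also have "\<dots> = e / 2 * (\<Sum>m\<le>n. (\<Sum>i\<le>n - m. W $ i) * G $ m) + B * (\<Sum>m\<le>n. G $ m)"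
        by (simp only: distrib_right sum.distrib mult.assoc sum_distrib_left[symmetric])
      also have "\<dots> = e / 2 * (real n * H $ n) + B * H $ n"
        by (simp only: nH Hsum[symmetric])
      finally show ?thesis by (simp add: algebra_simps)
    qed
    \<comment> \<open>From \<open>N\<close> on, \<open>B\<close> is below \<open>e / 2 * n\<close>,
      so the factor in \<open>key\<close> drops below \<open>e * n\<close>.\<close>
    obtain N where N: "B / (e / 2) < real N" using reals_Archimedean2 by blast
    show "\<exists>no. \<forall>n\<ge>no. norm (G $ n / H $ n - 0) < e"
    proof (intro exI allI impI)
      fix n assume n: "n \<ge> Suc N"
      have "B < e / 2 * real n"
        using N n e by (simp add: divide_less_eq mult.commute)
          (rule less_le_trans, assumption, auto intro!: mult_right_mono)
      then have "(e / 2 * real n + B) * H $ n < (e * real n) * H $ n"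
        using H1[of n] by (intro mult_strict_right_mono) auto
      then have "real n * G $ n < real n * (e * H $ n)"
        using key[of n] by (simp add: algebra_simps)
      then have "G $ n < e * H $ n"
        by (rule mult_left_less_imp_less) simp
      then show "norm (G $ n / H $ n - 0) < e"
        using H1[of n] Gnn[of n] by (simp add: divide_less_eq)
    qed
  qed
  then have "(\<lambda>n. 1 - G $ Suc n / H $ Suc n) \<longlonglongrightarrow> 1 - 0"
    by (intro tendsto_intros LIMSEQ_Suc)
  moreover have "1 - G $ Suc n / H $ Suc n = H $ n / H $ Suc n" for n
    using H1[of "Suc n"] HG[of n] by (simp add: field_simps)
  ultimately show "(\<lambda>n. H $ n / H $ Suc n) \<longlonglongrightarrow> 1"
    by simp
qed

text \<open>Dividing \<open>H\<close> by \<open>L ^ s\<close> adds \<open>s * (1/2) ^ k\<close> to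
  the weights and lifts the finitely many small ones to at least 1. The quotient \<open>T\<close>
  falls under \<open>log_deriv_ratio_ge_one\<close>, and \<open>H / T\<close> tends to the positive
  value of \<open>L ^ s\<close> at 1, so both conclusions carry over from \<open>T\<close>.\<close>

lemma log_deriv_ratio:
  fixes H W :: "real fps"
  assumes XH: "fps_X * fps_deriv H = W * H" and H0: "H $ 0 = 1" and Hpos: "\<And>n. H $ n > 0"
    and W0: "W $ 0 = 0" and Wnn: "\<And>k. W $ k \<ge> 0"
    and W1: "\<forall>\<^sub>F k in sequentially. W $ k \<ge> 1"
    and small: "\<And>e. e > 0 \<Longrightarrow> \<forall>\<^sub>F k in sequentially. W $ k \<le> e * (\<Sum>i\<le>k. W $ i)"
  shows "(\<lambda>n. H $ n / H $ Suc n) \<longlonglongrightarrow> 1"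
    and "\<exists>K>0. \<forall>n. \<forall>m\<le>n. H $ m \<le> K * H $ n"
proof -
  obtain J where J: "\<And>k. k \<ge> J \<Longrightarrow> W $ k \<ge> 1"
    using W1 by (auto simp: eventually_sequentially)
  \<comment> \<open>With this choice \<open>s * (1/2) ^ k\<close> is at least 1 for all k \<le>
    J.\<close>
  define s :: nat where "s = 2 ^ J"
  define L :: "real fps" where "L = 1 - fps_const (1/2) * fps_X"
  define Z :: "real fps" where "Z = Abs_fps (\<lambda>k. if k = 0 then 0 else - ((1/2) ^ k))"
  define T where "T = inverse L ^ s * H"
  define V where "V = of_nat s * (- Z) + W"
  have L0: "L $ 0 = 1" by (simp add: L_def)
  have XL: "fps_X * fps_deriv L = Z * L"
    unfolding L_def Z_def by (rule fps_X_deriv_one_minus)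
  have "fps_X * fps_deriv (inverse L ^ s) = (of_nat s * (- Z)) * inverse L ^ s"
    by (rule fps_X_deriv_power[OF fps_X_deriv_inverse[OF XL]]) (simp add: L0)
  then have XT: "fps_X * fps_deriv T = V * T"
    unfolding T_def V_def by (rule fps_X_deriv_mult[OF _ XH])
  have T0: "T $ 0 = 1"
    by (simp add: T_def L0 H0 fps_power_zeroth)
  have V: "V $ k = (if k = 0 then 0 else real s * (1/2) ^ k + W $ k)" for k
  proof -
    have "(of_nat s * (- Z)) $ k = real s * (- Z) $ k"
      by (metis fps_mult_left_const_nth fps_of_nat)
    then show ?thesis
      unfolding V_def by (simp add: Z_def W0)
  qed
  have V0: "V $ 0 = 0" by (simp add: V)
  have V1: "V $ k \<ge> 1" if "k \<ge> 1" for k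
  proof (cases "k \<ge> J")
    case True
    then show ?thesis using J[of k] that by (simp add: V add_increasing)
  next
    case False
    then have "(1/2::real) ^ J \<le> (1/2) ^ k"
      by (intro power_decreasing) auto
    then have "real s * (1/2) ^ J \<le> real s * (1/2) ^ k"
      by (intro mult_left_mono) auto
    moreover have "real s * (1/2) ^ J = 1"
      by (simp add: s_def power_divide)
    ultimately show ?thesis using Wnn[of k] that by (simp add: V)
  qed
  have VW: "W $ k \<le> V $ k" "V $ k \<le> real s + W $ k" for k
  proof -
    have "real s * (1/2) ^ k \<le> real s * 1"
      by (intro mult_left_mono power_le_one) auto
    then show "W $ k \<le> V $ k" "V $ k \<le> real s + W $ k"
      by (auto simp: V W0)
  qed
  \<comment> \<open>The constant absorbs the \<open>W k\<close> with k < N and the amount, at most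
    \<open>s\<close>, by which \<open>V\<close> exceeds \<open>W\<close>.\<close>
  have Vsmall: "\<exists>B. \<forall>k. V $ k \<le> e * (\<Sum>i\<le>k. V $ i) + B" if e: "e > 0" for e
  proof -
    obtain N where N: "\<And>k. k \<ge> N \<Longrightarrow> W $ k \<le> e * (\<Sum>i\<le>k. W $ i)"
      using small[OF e] by (auto simp: eventually_sequentially)
    show ?thesis
    proof (intro exI allI)
      fix k
      have mono: "e * (\<Sum>i\<le>k. W $ i) \<le> e * (\<Sum>i\<le>k. V $ i)"
        using e by (intro mult_left_mono sum_mono VW) auto
      have nn: "(\<Sum>i\<le>k. W $ i) \<ge> 0" "(\<Sum>i<N. W $ i) \<ge> 0"
        using Wnn by (auto intro: sum_nonneg)
      have "W $ k \<le> e * (\<Sum>i\<le>k. W $ i) + (\<Sum>i<N. W $ i)"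
      proof (cases "k < N")
        case True
        then have "W $ k \<le> (\<Sum>i<N. W $ i)"
          using Wnn by (intro member_le_sum) auto
        then show ?thesis using nn e by (smt (verit) mult_nonneg_nonneg)
      qed (use N[of k] nn in auto)
      then show "V $ k \<le> e * (\<Sum>i\<le>k. V $ i) + ((\<Sum>i<N. W $ i) + real s)"
        using VW(2)[of k] mono by linarith
    qed
  qed
  note T = log_deriv_ratio_ge_one[OF XT T0 V0 V1 Vsmall]
  have Tpos: "T $ n > 0" for n using T(2)[of n] by linarith
  have HT: "H = L ^ s * T"
    using inverse_mult_eq_1'[of L] L0
    by (simp add: T_def flip: mult.assoc power_mult_distrib)
  have "(\<lambda>n. T $ n / T $ n) \<longlonglongrightarrow> 1"
    using Tpos by (simp add: less_imp_neq[THEN not_sym])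
  from ratio_limit_one_minus_power[OF this _ T(3), of "1/2" s] Tpos
  have lim: "(\<lambda>n. H $ n / T $ n) \<longlonglongrightarrow> (1/2) ^ s"
    by (simp add: HT L_def less_imp_neq[THEN not_sym])
  then have lim': "(\<lambda>n. T $ n / H $ n) \<longlonglongrightarrow> inverse ((1/2) ^ s)"
    using tendsto_inverse[OF lim] by (simp add: field_simps)
  have "(\<lambda>n. (H $ n / T $ n) * (T $ n / T $ Suc n) * (T $ Suc n / H $ Suc n))
      \<longlonglongrightarrow> (1/2) ^ s * 1 * inverse ((1/2) ^ s)"
    by (intro tendsto_mult lim T(3) LIMSEQ_Suc[OF lim'])
  moreover have "(H $ n / T $ n) * (T $ n / T $ Suc n) * (T $ Suc n / H $ Suc n)
      = H $ n / H $ Suc n" for n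
    using Tpos[of n] Tpos[of "Suc n"] by simp
  moreover have "(1/2::real) ^ s * 1 * inverse ((1/2) ^ s) = 1"
    by simp
  ultimately show "(\<lambda>n. H $ n / H $ Suc n) \<longlonglongrightarrow> 1"
    by (simp only:)
  obtain K1 where K1: "K1 > 0" "\<And>n. norm (H $ n / T $ n) \<le> K1"
    using convergent_imp_Bseq[OF convergentI[OF lim]] by (auto elim: BseqE)
  obtain K2 where K2: "K2 > 0" "\<And>n. norm (T $ n / H $ n) \<le> K2"
    using convergent_imp_Bseq[OF convergentI[OF lim']] by (auto elim: BseqE)
  \<comment> \<open>\<open>H\<close> itself need not increase: the comparison passes to the monotone
    \<open>T\<close> and back.\<close>
  have "H $ m \<le> (K1 * K2) * H $ n" if "m \<le> n" for m n
  proof -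
    have "H $ m \<le> K1 * T $ m"
      using K1(2)[of m] Hpos[of m] Tpos[of m] by (simp add: divide_le_eq)
    also have "\<dots> \<le> K1 * T $ n"
      using K1(1) monoD[OF T(1) that] by simp
    also have "\<dots> \<le> K1 * (K2 * H $ n)"
      using K2(2)[of n] K1(1) Hpos[of n] Tpos[of n] by (simp add: divide_le_eq)
    finally show ?thesis by (simp add: mult.assoc)
  qed
  then show "\<exists>K>0. \<forall>n. \<forall>m\<le>n. H $ m \<le> K * H $ n"
    using K1(1) K2(1) by (intro exI[of _ "K1 * K2"]) auto
qed

unbundle no fps_syntax

section \<open>Counting multisets and densities of events\<close>

locale sized_types =
  fixes C :: "'s set" and sz :: "'s \<Rightarrow> nat"
  assumes finite_level: "finite {S \<in> C. sz S = j}"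
    and sz_pos: "S \<in> C \<Longrightarrow> sz S > 0"
begin

definition weight :: "'s multiset \<Rightarrow> nat" where
  "weight M = (\<Sum>S\<in>#M. sz S)"

definition Om :: "nat \<Rightarrow> 's multiset set" where
  "Om n = {M. set_mset M \<subseteq> C \<and> weight M = n}"

definition c :: "nat \<Rightarrow> nat" where
  "c n = card (Om n)"

lemma weight_simps [simp]:
  "weight {#} = 0" "weight (add_mset S M) = sz S + weight M"
  "weight (M + N) = weight M + weight N" "weight (replicate_mset i S) = i * sz S"
  by (simp_all add: weight_def)

lemma sz_le_weight: "S \<in># M \<Longrightarrow> sz S \<le> weight M"
  by (auto dest!: multi_member_split)

lemma size_le_weight: "set_mset M \<subseteq> C \<Longrightarrow> size M \<le> weight M"
  by (induction M) (auto dest: sz_pos)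

lemma weight_eq_sum_count: "weight M = (\<Sum>S\<in>set_mset M. count M S * sz S)"
proof (induction M)
  case (add S M)
  let ?D = "set_mset (add_mset S M)"
  have "(\<Sum>T\<in>?D. count (add_mset S M) T * sz T) =
      (\<Sum>T\<in>?D. count M T * sz T + (if T = S then sz S else 0))"
    by (rule sum.cong) auto
  also have "\<dots> = (\<Sum>T\<in>?D. count M T * sz T) + sz S"
    by (simp add: sum.distrib)
  also have "(\<Sum>T\<in>?D. count M T * sz T) = (\<Sum>T\<in>set_mset M. count M T * sz T)"
    by (rule sum.mono_neutral_right) (auto simp: count_eq_zero_iff)
  finally show ?case using add.IH by simp
qed simp

lemma finite_le_level: "finite {S \<in> C. sz S \<le> n}"
proof -
  have "{S \<in> C. sz S \<le> n} = (\<Union>j\<le>n. {S \<in> C. sz S = j})" by auto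
  then show ?thesis using finite_level by simp
qed

lemma finite_Om: "finite (Om n)"
proof (rule finite_subset)
  show "Om n \<subseteq> mset ` {xs. set xs \<subseteq> {S \<in> C. sz S \<le> n} \<and> length xs \<le> n}"
  proof
    fix M assume M: "M \<in> Om n"
    obtain xs where xs: "M = mset xs" by (metis ex_mset)
    have "set xs \<subseteq> {S \<in> C. sz S \<le> n}" "length xs \<le> n"
      using M sz_le_weight[of _ M] size_le_weight[of M] by (auto simp: Om_def xs)
    then show "M \<in> mset ` {xs. set xs \<subseteq> {S \<in> C. sz S \<le> n} \<and> length xs \<le> n}"
      using xs by blast
  qed
  show "finite (mset ` {xs. set xs \<subseteq> {S \<in> C. sz S \<le> n} \<and> length xs \<le> n})"
    using finite_lists_length_le[OF finite_le_level] by simp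
qed

lemma Om_0: "Om 0 = {{#}}"
proof -
  have "M = {#}" if "M \<in> Om 0" for M
    using size_le_weight[of M] that by (simp add: Om_def)
  then show ?thesis by (auto simp: Om_def)
qed

lemma c_0: "c 0 = 1"
  by (simp add: c_def Om_0)

text \<open>Removing \<open>N\<close> is a bijection onto the multisets of the smaller size, since
  \<open>A\<close> is insensitive to adding \<open>N\<close>. The property \<open>A\<close> will be
  trivial or the avoidance of other components.\<close>

lemma card_Om_supersets:
  assumes "set_mset N \<subseteq> C"
    and "\<And>M. A (M + N) \<longleftrightarrow> A M"
  shows "card {M \<in> Om n. A M \<and> N \<subseteq># M} =
    (if weight N \<le> n then card {M \<in> Om (n - weight N). A M} else 0)"
proof (cases "weight N \<le> n")
  case True
  have "bij_betw (\<lambda>M. M + N) {M \<in> Om (n - weight N). A M} {M \<in> Om n. A M \<and> N \<subseteq># M}"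
  proof (rule bij_betw_imageI)
    show "inj_on (\<lambda>M. M + N) {M \<in> Om (n - weight N). A M}"
      by (rule inj_onI) simp
    show "(\<lambda>M. M + N) ` {M \<in> Om (n - weight N). A M} = {M \<in> Om n. A M \<and> N \<subseteq># M}"
    proof (intro equalityI subsetI)
      fix M assume "M \<in> (\<lambda>M. M + N) ` {M \<in> Om (n - weight N). A M}"
      then show "M \<in> {M \<in> Om n. A M \<and> N \<subseteq># M}"
        using assms True by (auto simp: Om_def)
    next
      fix M assume M: "M \<in> {M \<in> Om n. A M \<and> N \<subseteq># M}"
      then obtain M' where M': "M = M' + N" by (metis subset_mset.diff_add mem_Collect_eq)
      then have "M' \<in> {M \<in> Om (n - weight N). A M}"
        using M assms(2) by (auto simp: Om_def)
      then show "M \<in> (\<lambda>M. M + N) ` {M \<in> Om (n - weight N). A M}"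
        using M' by blast
    qed
  qed
  then show ?thesis using True by (simp add: bij_betw_same_card[symmetric])
next
  case False
  have "weight N \<le> weight M" if "N \<subseteq># M" for M
    using that by (auto elim!: subset_mset.le_iff_add[THEN iffD1, THEN exE])
  then have empty: "{M \<in> Om n. A M \<and> N \<subseteq># M} = {}" using False by (auto simp: Om_def)
  show ?thesis unfolding empty using False by simp
qed

lemma card_Om_count_ge:
  assumes "S \<in> C"
  shows "card {M \<in> Om n. i \<le> count M S} = (if i * sz S \<le> n then c (n - i * sz S) else 0)"
proof -
  have "set_mset (replicate_mset i S) \<subseteq> C"
    using assms by (simp add: set_mset_replicate_mset_subset)
  then show ?thesis
    using card_Om_supersets[of "replicate_mset i S" "\<lambda>_. True" n]
    by (simp add: c_def count_le_replicate_mset_subset_eq)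
qed

section \<open>The recurrence for the number of multisets\<close>

definition divisor_weight :: "nat \<Rightarrow> nat" where
  "divisor_weight k = (\<Sum>S | S \<in> C \<and> sz S dvd k. sz S)"

text \<open>Double counting of the total size of all multisets of size n. A component
  \<open>S\<close> contributes \<open>sz S\<close> for each i up to its multiplicity, and
  \<open>c (n - i * sz S)\<close> multisets contain it at least i times; the terms are collected by
  k = i * sz S.\<close>

lemma c_recurrence: "n * c n = (\<Sum>k=1..n. divisor_weight k * c (n - k))"
proof -
  let ?D = "{S \<in> C. sz S \<le> n}"
  have weight: "n = (\<Sum>S\<in>?D. \<Sum>i=1..n. sz S * of_bool (i \<le> count M S))" if M: "M \<in> Om n" for M
  proof -
    \<comment> \<open>The cutoff n loses nothing, because sizes are positive and hence
      multiplicities are at most n.\<close>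
    have cnt: "(\<Sum>i=1..n. of_bool (i \<le> count M S) :: nat) = count M S" for S
    proof -
      have "count M S \<le> n"
        using M size_le_weight[of M] count_le_size[of M S] by (auto simp: Om_def)
      then have "{1..n} \<inter> {i. i \<le> count M S} = {1..count M S}" by auto
      then show ?thesis by (simp add: sum_of_bool_eq)
    qed
    have "weight M = (\<Sum>S\<in>set_mset M. count M S * sz S)"
      by (rule weight_eq_sum_count)
    also have "\<dots> = (\<Sum>S\<in>?D. count M S * sz S)"
    proof (rule sum.mono_neutral_left[OF finite_le_level])
      show "set_mset M \<subseteq> ?D" using M sz_le_weight[of _ M] by (auto simp: Om_def)
    qed (auto simp: count_eq_zero_iff)
    also have "\<dots> = (\<Sum>S\<in>?D. sz S * (\<Sum>i=1..n. of_bool (i \<le> count M S)))"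
      by (simp only: cnt mult.commute)
    also have "weight M = n" using M by (simp add: Om_def)
    finally show ?thesis by (simp only: sum_distrib_left)
  qed
  have "n * c n = (\<Sum>M\<in>Om n. n)"
    by (simp add: c_def)
  also have "\<dots> = (\<Sum>M\<in>Om n. \<Sum>S\<in>?D. \<Sum>i=1..n. sz S * of_bool (i \<le> count M S))"
    using weight by (rule sum.cong[OF refl])
  also have "\<dots> = (\<Sum>S\<in>?D. \<Sum>i=1..n. \<Sum>M\<in>Om n. sz S * of_bool (i \<le> count M S))"
    by (subst sum.swap, intro sum.cong refl, rule sum.swap)
  also have "\<dots> = (\<Sum>S\<in>?D. \<Sum>i=1..n. sz S * (if i * sz S \<le> n then c (n - i * sz S) else 0))"
  proof (intro sum.cong refl)
    fix S i assume "S \<in> ?D"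
    then have "S \<in> C" by simp
    from card_Om_count_ge[OF this, of n i]
    show "(\<Sum>M\<in>Om n. sz S * of_bool (i \<le> count M S)) =
        sz S * (if i * sz S \<le> n then c (n - i * sz S) else 0)"
      by (simp add: finite_Om sum_of_bool_eq Int_def flip: sum_distrib_left)
  qed
  also have "\<dots> = (\<Sum>S\<in>?D. \<Sum>k=1..n. of_bool (sz S dvd k) * sz S * c (n - k))"
  proof (rule sum.cong[OF refl])
    fix S assume "S \<in> ?D"
    then have pos: "sz S > 0" using sz_pos by simp
    have "(\<Sum>i=1..n. sz S * (if i * sz S \<le> n then c (n - i * sz S) else 0)) =
        (\<Sum>i | i \<in> {1..n} \<and> i * sz S \<le> n. sz S * c (n - i * sz S))"
      by (rule sum.mono_neutral_cong_right) auto
    also have "\<dots> = (\<Sum>k | k \<in> {1..n} \<and> sz S dvd k. sz S * c (n - k))"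
      using pos by (intro sum.reindex_bij_witness[of _ "\<lambda>k. k div sz S" "\<lambda>i. i * sz S"])
        (auto elim!: dvdE intro: order.trans[rotated] simp: Suc_le_eq)
    also have "\<dots> = (\<Sum>k=1..n. of_bool (sz S dvd k) * sz S * c (n - k))"
      by (rule sum.mono_neutral_cong_left) auto
    finally show "(\<Sum>i=1..n. sz S * (if i * sz S \<le> n then c (n - i * sz S) else 0)) = \<dots>" .
  qed
  also have "\<dots> = (\<Sum>k=1..n. (\<Sum>S\<in>?D. of_bool (sz S dvd k) * sz S) * c (n - k))"
    by (subst sum.swap) (simp add: sum_distrib_right)
  also have "\<dots> = (\<Sum>k=1..n. divisor_weight k * c (n - k))"
  proof (intro sum.cong refl arg_cong2[of _ _ _ _ "(*)"])
    fix k assume k: "k \<in> {1..n}"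
    show "(\<Sum>S\<in>?D. of_bool (sz S dvd k) * sz S) = divisor_weight k"
      unfolding divisor_weight_def
      using k by (intro sum.mono_neutral_cong_right finite_le_level) (auto dest: dvd_imp_le)
  qed
  finally show ?thesis .
qed

lemma divisor_weight_eq:
  assumes "k > 0"
  shows "divisor_weight k = (\<Sum>d | d dvd k. d * card {S \<in> C. sz S = d})"
proof -
  have "divisor_weight k = (\<Sum>d | d dvd k. \<Sum>S | S \<in> {S \<in> C. sz S dvd k} \<and> sz S = d. sz S)"
    unfolding divisor_weight_def
  proof (subst sum.group)
    have "{S \<in> C. sz S dvd k} \<subseteq> {S \<in> C. sz S \<le> k}"
      using assms by (auto dest: dvd_imp_le)
    then show "finite {S \<in> C. sz S dvd k}"
      using finite_le_level finite_subset by blast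
  qed (use assms in auto)
  also have "\<dots> = (\<Sum>d | d dvd k. d * card {S \<in> C. sz S = d})"
  proof (rule sum.cong[OF refl])
    fix d assume "d \<in> {d. d dvd k}"
    then have "{S \<in> {S \<in> C. sz S dvd k}. sz S = d} = {S \<in> C. sz S = d}" by auto
    then show "(\<Sum>S | S \<in> {S \<in> C. sz S dvd k} \<and> sz S = d. sz S) = d * card {S \<in> C. sz S = d}"
      by (simp add: mult.commute)
  qed
  finally show ?thesis .
qed

end

text \<open>In the situation of the theorem \<open>\<rho>\<close> is \<open>1 / y\<close>.\<close>

locale smooth_types = sized_types C sz for C :: "'s set" and sz +
  fixes \<rho> K :: real
  assumes c_pos: "c n > 0"
    and rho_pos: "\<rho> > 0" and rho_le_1: "\<rho> \<le> 1" and K_pos: "K > 0"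
    and c_ratio: "(\<lambda>n. real (c n) / real (c (Suc n))) \<longlonglongrightarrow> \<rho>"
    and c_bound: "m \<le> n \<Longrightarrow> real (c m) \<le> K * \<rho> ^ (n - m) * real (c n)"
begin

lemma c_nonzero [simp]: "c n \<noteq> 0"
  using c_pos[of n] by simp

text \<open>The quotient of \<open>c (n - s)\<close> by \<open>c n\<close> tends to
  \<open>\<rho> ^ s\<close>, one factor \<rho> for each step of the shift. The value 0 below
  \<open>s\<close> only concerns finitely many n.\<close>

lemma shift_limit:
  assumes "(\<lambda>n. f n / real (c n)) \<longlonglongrightarrow> l"
  shows "(\<lambda>n. (if s \<le> n then f (n - s) else 0) / real (c n)) \<longlonglongrightarrow> \<rho> ^ s * l"
proof -
  have "(\<lambda>n. f n / real (c (n + s))) \<longlonglongrightarrow> \<rho> ^ s * l"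
  proof (induction s)
    case 0
    show ?case using assms by simp
  next
    case (Suc s)
    have "(\<lambda>n. (real (c (n + s)) / real (c (Suc (n + s)))) * (f n / real (c (n + s)))) \<longlonglongrightarrow> \<rho> * (\<rho> ^ s * l)"
      using LIMSEQ_ignore_initial_segment[OF c_ratio, of s] Suc.IH by (intro tendsto_mult) auto
    then show ?case
      by (simp add: mult.assoc)
  qed
  then have "(\<lambda>n. (if s \<le> n + s then f (n + s - s) else 0) / real (c (n + s))) \<longlonglongrightarrow> \<rho> ^ s * l"
    by simp
  then show ?thesis by (rule LIMSEQ_offset)
qed

section \<open>Probabilities and averages over the multisets of size n\<close>

definition Pr :: "nat \<Rightarrow> 's multiset set \<Rightarrow> real" where
  "Pr n A = real (card (Om n \<inter> A)) / real (c n)"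

definition avg :: "nat \<Rightarrow> ('s multiset \<Rightarrow> real) \<Rightarrow> real" where
  "avg n f = (\<Sum>M\<in>Om n. f M) / real (c n)"

lemma Pr_eq_avg: "Pr n A = avg n (\<lambda>M. of_bool (M \<in> A))"
  by (simp add: Pr_def avg_def finite_Om sum_of_bool_eq)

lemma Pr_mono: "Om n \<inter> A \<subseteq> B \<Longrightarrow> Pr n A \<le> Pr n B"
  unfolding Pr_def by (intro divide_right_mono) (auto intro!: card_mono simp: finite_Om)

lemma Pr_Un_le: "Pr n (A \<union> B) \<le> Pr n A + Pr n B"
proof -
  have "card (Om n \<inter> (A \<union> B)) \<le> card (Om n \<inter> A) + card (Om n \<inter> B)"
    by (simp add: Int_Un_distrib card_Un_le)
  then have "real (card (Om n \<inter> (A \<union> B))) \<le> real (card (Om n \<inter> A)) + real (card (Om n \<inter> B))"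
    by linarith
  then show ?thesis
    unfolding Pr_def by (simp add: divide_right_mono flip: add_divide_distrib)
qed

lemma Pr_diff_le: "\<bar>Pr n A - Pr n B\<bar> \<le> Pr n (sym_diff A B)"
proof -
  have "Pr n A \<le> Pr n B + Pr n (sym_diff A B)" for A B
    by (rule order.trans[OF Pr_mono Pr_Un_le]) auto
  from this[of A B] this[of B A] show ?thesis
    by (simp add: Un_commute abs_le_iff)
qed

text \<open>The linear span of the indicators of the events \<open>N \<subseteq># M\<close>, which is closed under products
  because \<open>N \<subseteq># M\<close> and \<open>N' \<subseteq># M\<close> together mean \<open>N \<union># N' \<subseteq># M\<close>.\<close>

inductive_set cyl :: "('s multiset \<Rightarrow> real) set" where
  base: "set_mset N \<subseteq> C \<Longrightarrow> (\<lambda>M. of_bool (N \<subseteq># M)) \<in> cyl"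
| add: "f \<in> cyl \<Longrightarrow> g \<in> cyl \<Longrightarrow> (\<lambda>M. f M + g M) \<in> cyl"
| scale: "f \<in> cyl \<Longrightarrow> (\<lambda>M. r * f M) \<in> cyl"

lemma cyl_mult:
  assumes "f \<in> cyl" and "g \<in> cyl"
  shows "(\<lambda>M. f M * g M) \<in> cyl"
  using assms(1)
proof induction
  case (base N)
  show ?case using assms(2)
  proof induction
    case (base N')
    have "(\<lambda>M. of_bool (N \<union># N' \<subseteq># M)) \<in> cyl"
      using \<open>set_mset N \<subseteq> C\<close> base by (intro cyl.base) simp
    moreover have "N \<union># N' \<subseteq># M \<longleftrightarrow> N \<subseteq># M \<and> N' \<subseteq># M" for M
      by (rule subset_mset.le_sup_iff)
    ultimately show ?case by (simp add: of_bool_conj)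
  next
    case (add f g)
    then show ?case using cyl.add by (simp add: distrib_left)
  next
    case (scale f r)
    then show ?case using cyl.scale[OF scale.IH, of r] by (simp add: mult.left_commute)
  qed
next
  case (add f f')
  then show ?case using cyl.add by (simp add: distrib_right)
next
  case (scale f r)
  then show ?case using cyl.scale[OF scale.IH, of r] by (simp add: mult.assoc)
qed

text \<open>Averages are linear, and the probability of \<open>N \<subseteq># M\<close> tends to
  \<open>\<rho> ^ weight N\<close> because removing \<open>N\<close> only shifts the size.\<close>

lemma cyl_convergent:
  assumes "f \<in> cyl"
  shows "convergent (\<lambda>n. avg n f)"
  using assms
proof induction
  case (base N)
  have "real (c n) / real (c n) = 1" for n using c_pos[of n] by simp
  then have "(\<lambda>n. real (c n) / real (c n)) \<longlonglongrightarrow> 1" by simp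
  from shift_limit[OF this, of "weight N"]
  have "(\<lambda>n. (if weight N \<le> n then real (c (n - weight N)) else 0) / real (c n)) \<longlonglongrightarrow> \<rho> ^ weight N"
    by simp
  moreover have "avg n (\<lambda>M. of_bool (N \<subseteq># M)) =
      (if weight N \<le> n then real (c (n - weight N)) else 0) / real (c n)" for n
    using card_Om_supersets[OF base, of "\<lambda>_. True" n]
    by (simp add: avg_def sum_of_bool_eq finite_Om Int_def c_def)
  ultimately show ?case by (simp add: convergentI)
next
  case (add f g)
  then show ?case
    using convergent_add[OF add.IH] by (simp add: avg_def sum.distrib add_divide_distrib)
next
  case (scale f r)
  have "convergent (\<lambda>n. r * avg n f)"
    using scale.IH by (rule convergent_mult[OF convergent_const])
  then show ?case by (simp add: avg_def sum_distrib_left)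
qed

section \<open>The algebra of cylinder events\<close>

definition cyl_events :: "'s multiset set set" where
  "cyl_events = {A. (\<lambda>M. of_bool (M \<in> A)) \<in> cyl}"

lemma cyl_events_Compl:
  assumes "A \<in> cyl_events"
  shows "- A \<in> cyl_events"
proof -
  \<comment> \<open>The constant 1 is written as the indicator of containing the empty
    multiset.\<close>
  have "(\<lambda>M. of_bool ({#} \<subseteq># M) + (- 1) * of_bool (M \<in> A)) \<in> cyl"
    using assms by (intro cyl.intros) (auto simp: cyl_events_def)
  then show ?thesis by (simp add: cyl_events_def of_bool_not_iff)
qed

lemma cyl_events_Int: "A \<in> cyl_events \<Longrightarrow> B \<in> cyl_events \<Longrightarrow> A \<inter> B \<in> cyl_events"
  using cyl_mult[of "\<lambda>M. of_bool (M \<in> A)" "\<lambda>M. of_bool (M \<in> B)"]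
  by (simp add: cyl_events_def of_bool_conj)

lemma cyl_events_Un: "A \<in> cyl_events \<Longrightarrow> B \<in> cyl_events \<Longrightarrow> A \<union> B \<in> cyl_events"
  using cyl_events_Compl[OF cyl_events_Int[OF cyl_events_Compl cyl_events_Compl], of A B] by simp

lemma cyl_events_UNIV: "UNIV \<in> cyl_events"
  using cyl.base[of "{#}"] by (simp add: cyl_events_def)

lemma cyl_events_UN:
  "finite I \<Longrightarrow> (\<And>i. i \<in> I \<Longrightarrow> A i \<in> cyl_events) \<Longrightarrow> (\<Union>i\<in>I. A i) \<in> cyl_events"
  by (induction I rule: finite_induct)
    (use cyl_events_Compl[OF cyl_events_UNIV] in \<open>auto intro: cyl_events_Un\<close>)

lemma cyl_events_count: "S \<in> C \<Longrightarrow> {M. i \<le> count M S} \<in> cyl_events"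
  using cyl.base[of "replicate_mset i S"] set_mset_replicate_mset_subset[of i S]
  by (auto simp: cyl_events_def count_le_replicate_mset_subset_eq)

lemma cyl_events_finite_count:
  assumes "finite F" and "F \<subseteq> C"
  shows "{M. j \<le> size {#S \<in># M. S \<in> F#}} \<in> cyl_events"
  using assms
proof (induction F arbitrary: j rule: finite_induct)
  case empty
  show ?case
    using cyl_events_UNIV cyl_events_Compl[OF cyl_events_UNIV] by (cases "j = 0") simp_all
next
  case (insert S F)
  have size: "size {#T \<in># M. T \<in> insert S F#} = count M S + size {#T \<in># M. T \<in> F#}" for M
    using insert.hyps(2) by (induction M) auto
  \<comment> \<open>Split according to the number of copies of \<open>S\<close>, where only the
    first \<open>j\<close> of them matter.\<close>
  have "{M. j \<le> size {#T \<in># M. T \<in> insert S F#}} =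
      (\<Union>i\<in>{..j}. {M. i \<le> count M S} \<inter> {M. j - i \<le> size {#T \<in># M. T \<in> F#}})" (is "?L = ?R")
  proof (intro equalityI subsetI)
    fix M assume "M \<in> ?L"
    then have "j \<le> count M S + size {#T \<in># M. T \<in> F#}"
      by (simp only: size mem_Collect_eq)
    then have "M \<in> {M. min j (count M S) \<le> count M S} \<inter>
        {M. j - min j (count M S) \<le> size {#T \<in># M. T \<in> F#}}"
      by auto
    then show "M \<in> ?R" by (intro UN_I[of "min j (count M S)"]) auto
  next
    fix M assume "M \<in> ?R"
    then have "j \<le> count M S + size {#T \<in># M. T \<in> F#}" by auto
    then show "M \<in> ?L" by (simp only: size mem_Collect_eq)
  qed
  then show ?case
    using insert.IH insert.prems by (auto intro!: cyl_events_UN cyl_events_Int cyl_events_count)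
qed

section \<open>Events approximable by cylinder events\<close>

definition approximable :: "'s multiset set \<Rightarrow> bool" where
  "approximable A \<longleftrightarrow>
     (\<forall>e>0. \<exists>B\<in>cyl_events. \<forall>\<^sub>F n in sequentially. Pr n (sym_diff A B) \<le> e)"

lemma approximable_Compl: "approximable A \<Longrightarrow> approximable (- A)"
proof -
  assume A: "approximable A"
  have "sym_diff (- A) (- B) = sym_diff A B" for B :: "'s multiset set" by auto
  then show ?thesis
    using A cyl_events_Compl unfolding approximable_def by metis
qed

lemma approximable_Int:
  assumes "approximable A" and "approximable A'"
  shows "approximable (A \<inter> A')"
  unfolding approximable_def
proof (intro allI impI)
  fix e :: real assume e: "e > 0"
  obtain B where B: "B \<in> cyl_events" "\<forall>\<^sub>F n in sequentially. Pr n (sym_diff A B) \<le> e / 2"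
    using assms(1) e unfolding approximable_def by (meson half_gt_zero)
  obtain B' where B': "B' \<in> cyl_events" "\<forall>\<^sub>F n in sequentially. Pr n (sym_diff A' B') \<le> e / 2"
    using assms(2) e unfolding approximable_def by (meson half_gt_zero)
  have "\<forall>\<^sub>F n in sequentially. Pr n (sym_diff (A \<inter> A') (B \<inter> B')) \<le> e"
    using B(2) B'(2)
  proof eventually_elim
    case (elim n)
    have "Pr n (sym_diff (A \<inter> A') (B \<inter> B')) \<le> Pr n (sym_diff A B) + Pr n (sym_diff A' B')"
      by (rule order.trans[OF Pr_mono Pr_Un_le]) auto
    then show ?case using elim by linarith
  qed
  then show "\<exists>B\<in>cyl_events. \<forall>\<^sub>F n in sequentially. Pr n (sym_diff (A \<inter> A') B) \<le> e"
    using cyl_events_Int[OF B(1) B'(1)] by blast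
qed

lemma approximable_UNIV: "approximable UNIV"
  unfolding approximable_def by (intro allI impI bexI[OF _ cyl_events_UNIV]) (simp add: Pr_def)

lemma approximable_Un: "approximable A \<Longrightarrow> approximable B \<Longrightarrow> approximable (A \<union> B)"
  using approximable_Compl[OF approximable_Int[OF approximable_Compl approximable_Compl], of A B]
  by simp

lemma approximable_UN:
  "finite I \<Longrightarrow> (\<And>i. i \<in> I \<Longrightarrow> approximable (A i)) \<Longrightarrow> approximable (\<Union>i\<in>I. A i)"
  by (induction I rule: finite_induct)
    (use approximable_Compl[OF approximable_UNIV] in \<open>auto intro: approximable_Un\<close>)

lemma approximable_INT:
  "finite I \<Longrightarrow> (\<And>i. i \<in> I \<Longrightarrow> approximable (A i)) \<Longrightarrow> approximable (\<Inter>i\<in>I. A i)"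
  by (induction I rule: finite_induct) (auto intro: approximable_Int approximable_UNIV)

text \<open>For large n the probabilities of \<open>A\<close> stay within e / 4 of a convergent
  sequence, so they form a Cauchy sequence.\<close>

lemma approximable_convergent:
  assumes "approximable A"
  shows "convergent (\<lambda>n. Pr n A)"
proof -
  have "Cauchy (\<lambda>n. Pr n A)"
  proof (rule metric_CauchyI)
    fix e :: real assume e: "e > 0"
    obtain B where B: "B \<in> cyl_events" "\<forall>\<^sub>F n in sequentially. Pr n (sym_diff A B) \<le> e / 4"
      using assms e unfolding approximable_def by (meson zero_less_divide_iff zero_less_numeral)
    obtain N1 where N1: "\<And>n. n \<ge> N1 \<Longrightarrow> Pr n (sym_diff A B) \<le> e / 4"
      using B(2) by (auto simp: eventually_sequentially)
    have "Cauchy (\<lambda>n. Pr n B)"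
      using cyl_convergent B(1) by (simp add: cyl_events_def Pr_eq_avg convergent_Cauchy)
    then obtain N2 where N2: "\<And>m n. m \<ge> N2 \<Longrightarrow> n \<ge> N2 \<Longrightarrow> dist (Pr m B) (Pr n B) < e / 4"
      using e by (meson metric_CauchyD zero_less_divide_iff zero_less_numeral)
    show "\<exists>N. \<forall>m\<ge>N. \<forall>n\<ge>N. dist (Pr m A) (Pr n A) < e"
    proof (intro exI allI impI)
      fix m n assume "m \<ge> max N1 N2" "n \<ge> max N1 N2"
      then show "dist (Pr m A) (Pr n A) < e"
        using N1[of m] N1[of n] N2[of m n] Pr_diff_le[of m A B] Pr_diff_le[of n A B] e
        unfolding dist_real_def max.bounded_iff by linarith
    qed
  qed
  then show ?thesis by (rule Cauchy_convergent)
qed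

section \<open>Sets of components with finite or infinite weight sum\<close>

lemma Pr_meets_le:
  assumes G: "G \<subseteq> C" and bound: "\<And>F. finite F \<Longrightarrow> F \<subseteq> G \<Longrightarrow> (\<Sum>S\<in>F. \<rho> ^ sz S) \<le> e"
  shows "Pr n {M. \<exists>S\<in>#M. S \<in> G} \<le> K * e"
proof -
  let ?D = "{S \<in> G. sz S \<le> n}"
  have fin: "finite ?D" using finite_le_level[of n] by (rule rev_finite_subset) (use G in auto)
  \<comment> \<open>Union bound: by \<open>c_bound\<close> a component \<open>S\<close> occurs with
    probability at most \<open>K * \<rho> ^ sz S\<close>, uniformly in n.\<close>
  have "Om n \<inter> {M. \<exists>S\<in>#M. S \<in> G} \<subseteq> (\<Union>S\<in>?D. {M \<in> Om n. 1 \<le> count M S})"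
    using sz_le_weight by (fastforce simp: Om_def)
  then have "card (Om n \<inter> {M. \<exists>S\<in>#M. S \<in> G}) \<le> card (\<Union>S\<in>?D. {M \<in> Om n. 1 \<le> count M S})"
    using fin finite_Om by (intro card_mono) auto
  also have "\<dots> \<le> (\<Sum>S\<in>?D. card {M \<in> Om n. 1 \<le> count M S})"
    by (rule card_UN_le[OF fin])
  also have "\<dots> = (\<Sum>S\<in>?D. c (n - sz S))"
  proof (rule sum.cong[OF refl])
    fix S assume S: "S \<in> ?D"
    then have "S \<in> C" using G by auto
    from card_Om_count_ge[OF this, of n 1] S
    show "card {M \<in> Om n. 1 \<le> count M S} = c (n - sz S)" by simp
  qed
  finally have "real (card (Om n \<inter> {M. \<exists>S\<in>#M. S \<in> G})) \<le> (\<Sum>S\<in>?D. real (c (n - sz S)))"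
    by (simp flip: of_nat_sum)
  also have "\<dots> \<le> (\<Sum>S\<in>?D. K * \<rho> ^ sz S * real (c n))"
  proof (rule sum_mono)
    fix S assume "S \<in> ?D"
    then show "real (c (n - sz S)) \<le> K * \<rho> ^ sz S * real (c n)"
      using c_bound[of "n - sz S" n] by simp
  qed
  also have "\<dots> = K * (\<Sum>S\<in>?D. \<rho> ^ sz S) * real (c n)"
    by (simp add: sum_distrib_left sum_distrib_right)
  also have "\<dots> \<le> K * e * real (c n)"
    using bound[OF fin] K_pos by (intro mult_right_mono mult_left_mono) auto
  finally show ?thesis
    using c_pos[of n] by (simp add: Pr_def divide_le_eq)
qed

text \<open>Avoiding distinct components is asymptotically independent: deleting one
  \<open>S\<close> from a multiset that avoids \<open>F\<close> and contains \<open>S\<close> leaves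
  any smaller multiset avoiding \<open>F\<close>, so a new \<open>S\<close> brings the factor
  \<open>1 - \<rho> ^ sz S\<close>.\<close>

lemma Pr_avoids_limit:
  assumes "finite F" and "F \<subseteq> C"
  shows "(\<lambda>n. Pr n {M. \<forall>S\<in>F. S \<notin># M}) \<longlonglongrightarrow> (\<Prod>S\<in>F. 1 - \<rho> ^ sz S)"
  using assms
proof (induction F rule: finite_induct)
  case empty
  have "Pr n UNIV = 1" for n using c_pos[of n] by (simp add: Pr_def c_def)
  then show ?case by simp
next
  case (insert S F)
  define f where "f n = real (card {M \<in> Om n. \<forall>T\<in>F. T \<notin># M})" for n
  have f: "(\<lambda>n. f n / real (c n)) \<longlonglongrightarrow> (\<Prod>S\<in>F. 1 - \<rho> ^ sz S)"
    using insert by (simp add: Pr_def f_def Int_def)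
  have "Pr n {M. \<forall>T\<in>insert S F. T \<notin># M} =
      f n / real (c n) - (if sz S \<le> n then f (n - sz S) else 0) / real (c n)" for n
  proof -
    have "{#S#} \<subseteq># M \<longleftrightarrow> S \<in># M" for M by simp
    then have split: "{M \<in> Om n. \<forall>T\<in>F. T \<notin># M} = {M \<in> Om n. \<forall>T\<in>insert S F. T \<notin># M} \<union>
        {M \<in> Om n. (\<forall>T\<in>F. T \<notin># M) \<and> {#S#} \<subseteq># M}"
      by auto
    have "card {M \<in> Om n. \<forall>T\<in>F. T \<notin># M} = card {M \<in> Om n. \<forall>T\<in>insert S F. T \<notin># M} +
        card {M \<in> Om n. (\<forall>T\<in>F. T \<notin># M) \<and> {#S#} \<subseteq># M}"
      unfolding split by (rule card_Un_disjoint) (auto simp: finite_Om)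
    moreover have "card {M \<in> Om n. (\<forall>T\<in>F. T \<notin># M) \<and> {#S#} \<subseteq># M} =
        (if sz S \<le> n then card {M \<in> Om (n - sz S). \<forall>T\<in>F. T \<notin># M} else 0)"
    proof -
      have "(\<forall>T\<in>F. T \<notin># M + {#S#}) \<longleftrightarrow> (\<forall>T\<in>F. T \<notin># M)" for M
        using insert.hyps(2) by auto
      from card_Om_supersets[of "{#S#}" "\<lambda>M. \<forall>T\<in>F. T \<notin># M", OF _ this, of n] insert.prems
      show ?thesis by simp
    qed
    ultimately have "real (card {M \<in> Om n. \<forall>T\<in>insert S F. T \<notin># M}) =
        f n - (if sz S \<le> n then f (n - sz S) else 0)"
      by (simp add: f_def)
    then show ?thesis by (simp add: Pr_def Int_def diff_divide_distrib)
  qed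
  moreover have "(\<lambda>n. f n / real (c n) - (if sz S \<le> n then f (n - sz S) else 0) / real (c n))
      \<longlonglongrightarrow> (\<Prod>S\<in>F. 1 - \<rho> ^ sz S) - \<rho> ^ sz S * (\<Prod>S\<in>F. 1 - \<rho> ^ sz S)"
    by (intro tendsto_diff f shift_limit)
  ultimately have "(\<lambda>n. Pr n {M. \<forall>T\<in>insert S F. T \<notin># M})
      \<longlonglongrightarrow> (\<Prod>S\<in>F. 1 - \<rho> ^ sz S) - \<rho> ^ sz S * (\<Prod>S\<in>F. 1 - \<rho> ^ sz S)"
    by (simp only:)
  then show ?case
    using insert.hyps by (simp add: left_diff_distrib)
qed

text \<open>The limiting product is at most the exponential of minus the weight sum, since 1 - x
  \<le> exp (- x).\<close>

lemma Pr_avoids_small: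
  assumes "finite F" and "F \<subseteq> C" and "e > 0" and "(\<Sum>S\<in>F. \<rho> ^ sz S) > - ln e"
  shows "\<forall>\<^sub>F n in sequentially. Pr n {M. \<forall>S\<in>F. S \<notin># M} \<le> e"
proof -
  have "(\<Prod>S\<in>F. 1 - \<rho> ^ sz S) \<le> (\<Prod>S\<in>F. exp (- (\<rho> ^ sz S)))"
  proof (intro prod_mono conjI)
    fix S
    show "0 \<le> 1 - \<rho> ^ sz S" using rho_pos rho_le_1 by (simp add: power_le_one)
    show "1 - \<rho> ^ sz S \<le> exp (- (\<rho> ^ sz S))" using exp_ge_add_one_self[of "- (\<rho> ^ sz S)"] by simp
  qed
  also have "\<dots> = exp (- (\<Sum>S\<in>F. \<rho> ^ sz S))"
    using assms(1) by (simp add: exp_sum flip: sum_negf)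
  also have "\<dots> < exp (ln e)"
    using assms(4) by simp
  also have "\<dots> = e" using assms(3) by simp
  finally have "\<forall>\<^sub>F n in sequentially. Pr n {M. \<forall>S\<in>F. S \<notin># M} < e"
    by (rule order_tendstoD(2)[OF Pr_avoids_limit[OF assms(1,2)]])
  then show ?thesis by eventually_elim simp
qed

text \<open>Induction on \<open>j\<close>: a divergent sum leaves room for a finite set
  \<open>F'\<close>, disjoint from the previous \<open>F\<close>, that is rarely avoided. At most
  \<open>j\<close> members in \<open>F' \<union> F\<close> force avoidance of \<open>F'\<close> or
  fewer than \<open>j\<close> members in \<open>F\<close>.\<close>

lemma Pr_few_small:
  assumes G: "G \<subseteq> C" and big: "\<And>B. \<exists>F. finite F \<and> F \<subseteq> G \<and> (\<Sum>S\<in>F. \<rho> ^ sz S) > B" and "e > 0"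
  shows "\<exists>F. finite F \<and> F \<subseteq> G \<and>
    (\<forall>\<^sub>F n in sequentially. Pr n {M. size {#S \<in># M. S \<in> F#} < j} \<le> e)"
  using \<open>e > 0\<close>
proof (induction j arbitrary: e)
  case 0
  then show ?case by (intro exI[of _ "{}"]) (simp add: Pr_def)
next
  case (Suc j)
  obtain F where F: "finite F" "F \<subseteq> G"
    "\<forall>\<^sub>F n in sequentially. Pr n {M. size {#S \<in># M. S \<in> F#} < j} \<le> e / 2"
    using Suc.IH[of "e / 2"] Suc.prems by auto
  \<comment> \<open>The sum over \<open>F\<close> is added to the demand because \<open>F0\<close>
    may overlap \<open>F\<close>; what remains after removing \<open>F\<close> is still large
    enough.\<close>
  obtain F0 where F0: "finite F0" "F0 \<subseteq> G"
    "(\<Sum>S\<in>F0. \<rho> ^ sz S) > - ln (e / 2) + (\<Sum>S\<in>F. \<rho> ^ sz S)"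
    using big by blast
  define F' where "F' = F0 - F"
  have F': "finite F'" "F' \<subseteq> C" using F0 G by (auto simp: F'_def)
  have "(\<Sum>S\<in>F0. \<rho> ^ sz S) \<le> (\<Sum>S\<in>F' \<union> F. \<rho> ^ sz S)"
    using F0 F rho_pos by (intro sum_mono2) (auto simp: F'_def)
  also have "\<dots> = (\<Sum>S\<in>F'. \<rho> ^ sz S) + (\<Sum>S\<in>F. \<rho> ^ sz S)"
    using F' F by (intro sum.union_disjoint) (auto simp: F'_def)
  finally have "(\<Sum>S\<in>F'. \<rho> ^ sz S) > - ln (e / 2)" using F0(3) by linarith
  then have avoid: "\<forall>\<^sub>F n in sequentially. Pr n {M. \<forall>S\<in>F'. S \<notin># M} \<le> e / 2"
    using Suc.prems by (intro Pr_avoids_small F') auto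
  have "{M. size {#S \<in># M. S \<in> F' \<union> F#} < Suc j} \<subseteq>
      {M. \<forall>S\<in>F'. S \<notin># M} \<union> {M. size {#S \<in># M. S \<in> F#} < j}"
  proof
    fix M assume M: "M \<in> {M. size {#S \<in># M. S \<in> F' \<union> F#} < Suc j}"
    have split: "size {#S \<in># M. S \<in> F' \<union> F#} = size {#S \<in># M. S \<in> F'#} + size {#S \<in># M. S \<in> F#}"
      by (induction M) (auto simp: F'_def)
    show "M \<in> {M. \<forall>S\<in>F'. S \<notin># M} \<union> {M. size {#S \<in># M. S \<in> F#} < j}"
    proof (cases "\<forall>S\<in>F'. S \<notin># M")
      case False
      then obtain S where "S \<in># {#S \<in># M. S \<in> F'#}" by auto
      then have "size {#S \<in># M. S \<in> F'#} > 0" by (metis nonempty_has_size empty_not_add_mset multi_member_split)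
      then show ?thesis using M split by simp
    qed simp
  qed
  then have le: "Pr n {M. size {#S \<in># M. S \<in> F' \<union> F#} < Suc j} \<le>
      Pr n {M. \<forall>S\<in>F'. S \<notin># M} + Pr n {M. size {#S \<in># M. S \<in> F#} < j}" for n
    by (intro order.trans[OF Pr_mono Pr_Un_le]) auto
  have "\<forall>\<^sub>F n in sequentially. Pr n {M. size {#S \<in># M. S \<in> F' \<union> F#} < Suc j} \<le> e"
    using avoid F(3)
  proof eventually_elim
    case (elim n)
    then show ?case using le[of n] by linarith
  qed
  then show ?case
    using F F0 F' by (intro exI[of _ "F' \<union> F"]) (auto simp: F'_def)
qed

text \<open>If the weights of the components in \<open>P\<close> have unbounded finite sums, the
  event has probability tending to 1 and \<open>UNIV\<close> approximates it. Otherwise a finite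
  part \<open>F\<close> carries almost all of the weight, and counting members of \<open>F\<close>
  alone is a cylinder event.\<close>

lemma approximable_count_ge: "approximable {M. j \<le> size (filter_mset P M)}"
proof -
  define G where "G = {S \<in> C. P S}"
  have GC: "G \<subseteq> C" by (auto simp: G_def)
  have filter_le: "size {#S \<in># M. S \<in> F#} \<le> size (filter_mset P M)" if "F \<subseteq> G" for F M
  proof (induction M)
    case (add S M)
    then show ?case using that by (auto simp: G_def)
  qed simp
  show ?thesis
  proof (cases "\<forall>B. \<exists>F. finite F \<and> F \<subseteq> G \<and> (\<Sum>S\<in>F. \<rho> ^ sz S) > B")
    case True
    show ?thesis
      unfolding approximable_def
    proof (intro allI impI bexI[OF _ cyl_events_UNIV])
      fix e :: real assume "e > 0"
      then obtain F where F: "finite F" "F \<subseteq> G"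
        "\<forall>\<^sub>F n in sequentially. Pr n {M. size {#S \<in># M. S \<in> F#} < j} \<le> e"
        using Pr_few_small[OF GC, of e j] True by blast
      show "\<forall>\<^sub>F n in sequentially. Pr n (sym_diff {M. j \<le> size (filter_mset P M)} UNIV) \<le> e"
        using F(3)
      proof eventually_elim
        case (elim n)
        have "Pr n (sym_diff {M. j \<le> size (filter_mset P M)} UNIV) \<le>
            Pr n {M. size {#S \<in># M. S \<in> F#} < j}"
        proof (rule Pr_mono, rule subsetI)
          fix M assume "M \<in> Om n \<inter> sym_diff {M. j \<le> size (filter_mset P M)} UNIV"
          then have "\<not> j \<le> size (filter_mset P M)" by auto
          then show "M \<in> {M. size {#S \<in># M. S \<in> F#} < j}"
            using filter_le[OF F(2), of M] by simp
        qed
        then show ?case using elim by linarith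
      qed
    qed
  next
    case False
    define X where "X = {\<Sum>S\<in>F. \<rho> ^ sz S | F. finite F \<and> F \<subseteq> G}"
    obtain B where "\<And>F. finite F \<Longrightarrow> F \<subseteq> G \<Longrightarrow> (\<Sum>S\<in>F. \<rho> ^ sz S) \<le> B"
      using False by (auto simp: not_less)
    then have bdd: "bdd_above X" by (intro bdd_aboveI[of _ B]) (auto simp: X_def)
    have "(\<Sum>S\<in>{}. \<rho> ^ sz S) \<in> X" unfolding X_def by blast
    then have X0: "X \<noteq> {}" by blast
    show ?thesis
      unfolding approximable_def
    proof (intro allI impI)
      fix e :: real assume e: "e > 0"
      \<comment> \<open>The tail beyond \<open>F\<close> is made smaller than \<open>e / K\<close>
        to offset the factor \<open>K\<close> in \<open>Pr_meets_le\<close>.\<close>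
      then have "Sup X - e / K < Sup X" using K_pos by simp
      then obtain F where F: "finite F" "F \<subseteq> G" "Sup X - e / K < (\<Sum>S\<in>F. \<rho> ^ sz S)"
        using less_cSup_iff[OF X0 bdd] unfolding X_def by blast
      have tail: "(\<Sum>S\<in>F'. \<rho> ^ sz S) \<le> e / K" if "finite F'" "F' \<subseteq> G - F" for F'
      proof -
        have "(\<Sum>S\<in>F \<union> F'. \<rho> ^ sz S) \<in> X" using that F unfolding X_def by blast
        then have "(\<Sum>S\<in>F \<union> F'. \<rho> ^ sz S) \<le> Sup X" by (rule cSup_upper[OF _ bdd])
        moreover have "(\<Sum>S\<in>F \<union> F'. \<rho> ^ sz S) = (\<Sum>S\<in>F. \<rho> ^ sz S) + (\<Sum>S\<in>F'. \<rho> ^ sz S)"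
          using that F by (intro sum.union_disjoint) auto
        ultimately show ?thesis using F(3) by linarith
      qed
      have "Pr n (sym_diff {M. j \<le> size (filter_mset P M)} {M. j \<le> size {#S \<in># M. S \<in> F#}}) \<le> e" for n
      proof -
        have "size (filter_mset P M) = size {#S \<in># M. S \<in> F#}"
          if "M \<in> Om n" "\<not> (\<exists>S\<in>#M. S \<in> G - F)" for M
        proof -
          have "filter_mset P M = {#S \<in># M. S \<in> F#}"
            using that F(2) by (intro filter_mset_cong refl) (auto simp: Om_def G_def)
          then show ?thesis by simp
        qed
        then have "Pr n (sym_diff {M. j \<le> size (filter_mset P M)} {M. j \<le> size {#S \<in># M. S \<in> F#}}) \<le>
            Pr n {M. \<exists>S\<in>#M. S \<in> G - F}"
          by (intro Pr_mono) auto
        also have "\<dots> \<le> K * (e / K)"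
          using GC tail by (intro Pr_meets_le) auto
        finally show ?thesis using K_pos by simp
      qed
      then show "\<exists>B\<in>cyl_events. \<forall>\<^sub>F n in sequentially.
          Pr n (sym_diff {M. j \<le> size (filter_mset P M)} B) \<le> e"
        using cyl_events_finite_count[OF F(1), of j] F(2) GC
        by (intro bexI[of _ "{M. j \<le> size {#S \<in># M. S \<in> F#}}"]) auto
    qed
  qed
qed

end

context smooth_types
begin

section \<open>Convergence for threshold properties of types\<close>

lemma count_type: "count (image_mset \<tau> M) \<alpha> = size {#S \<in># M. \<tau> S = \<alpha>#}"
  by (induction M) auto

lemma approximable_count_capped: "approximable {M. min t (count (image_mset \<tau> M) \<alpha>) = j}"
proof -
  let ?U = "\<lambda>i. {M. i \<le> count (image_mset \<tau> M) \<alpha>}"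
  have U: "approximable (?U i)" for i
    unfolding count_type by (rule approximable_count_ge)
  \<comment> \<open>The capped count is \<open>j\<close> if the count is exactly \<open>j\<close>
    below the cap or at least \<open>t\<close> at the cap; larger values are impossible.\<close>
  have "{M. min t (count (image_mset \<tau> M) \<alpha>) = j} =
      (if j < t then ?U j \<inter> - ?U (Suc j) else if j = t then ?U t else - UNIV)"
    by (auto simp: min_def)
  moreover have "approximable (- UNIV)"
    by (rule approximable_Compl[OF approximable_UNIV])
  ultimately show ?thesis
    using U by (simp add: approximable_Int approximable_Compl)
qed

text \<open>By \<open>stable_capped\<close>, \<open>g\<close> is constant on each set
  \<open>E v\<close> of multisets with a given vector \<open>v\<close> of capped counts. The event
  is therefore a finite union of such sets, each a finite intersection of approximable
  events.\<close>

lemma stable_event_convergent: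
  assumes A: "finite A" and g: "stable A t g" and \<tau>: "\<And>S. \<tau> S \<in> A"
  shows "convergent (\<lambda>n. Pr n {M. g (image_mset \<tau> M)})"
proof -
  define E where "E v = (\<Inter>\<alpha>\<in>A. {M. min t (count (image_mset \<tau> M) \<alpha>) = v \<alpha>})" for v
  define V where "V = {v \<in> A \<rightarrow>\<^sub>E {..t}. \<exists>M \<in> E v. g (image_mset \<tau> M)}"
  have sub: "set_mset (image_mset \<tau> M) \<subseteq> A" for M using \<tau> by auto
  have "finite V" unfolding V_def using A by (intro finite_Collect_conjI disjI1) (simp add: finite_PiE)
  then have "approximable (\<Union>v\<in>V. E v)"
    unfolding E_def by (intro approximable_UN approximable_INT A approximable_count_capped)
  moreover have "(\<Union>v\<in>V. E v) = {M. g (image_mset \<tau> M)}"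
  proof (intro equalityI subsetI)
    fix M assume "M \<in> (\<Union>v\<in>V. E v)"
    then obtain v M' where v: "M \<in> E v" "M' \<in> E v" "g (image_mset \<tau> M')" by (auto simp: V_def)
    have "g (image_mset \<tau> M) = g (image_mset \<tau> M')"
      using v(1,2) by (intro stable_capped[OF g sub sub]) (simp add: E_def)
    then show "M \<in> {M. g (image_mset \<tau> M)}" using v(3) by simp
  next
    fix M assume M: "M \<in> {M. g (image_mset \<tau> M)}"
    define v where "v = restrict (\<lambda>\<alpha>. min t (count (image_mset \<tau> M) \<alpha>)) A"
    have "M \<in> E v" by (simp add: E_def v_def)
    moreover have "v \<in> V" using M \<open>M \<in> E v\<close> by (auto simp: V_def v_def)
    ultimately show "M \<in> (\<Union>v\<in>V. E v)" by blast
  qed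
  ultimately show ?thesis using approximable_convergent by simp
qed

end

section \<open>Expansive multisets\<close>

text \<open>A divisor of \<open>k\<close> is at most \<open>k div m\<close>, or its cofactor is at
  most \<open>m\<close>. With \<open>m\<close> fixed but large, this shows that the number of
  divisors is o(k).\<close>

lemma card_divisors_le:
  assumes "m > 0" and "k > 0"
  shows "real (card {d. d dvd k}) \<le> real k / real m + real m"
proof -
  have "{d. d dvd k} \<subseteq> {1..k div m} \<union> (\<lambda>i. k div i) ` {1..m}"
  proof
    fix d assume "d \<in> {d. d dvd k}"
    then obtain i where i: "k = d * i" by auto
    have pos: "d > 0" "i > 0" using i assms(2) by auto
    show "d \<in> {1..k div m} \<union> (\<lambda>i. k div i) ` {1..m}"
    proof (cases "i \<le> m")
      case True
      have "d = k div i" using i pos by simp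
      then show ?thesis using True pos by auto
    next
      case False
      then have "d * m \<le> k" using i by simp
      then have "d \<le> k div m" using assms(1) by (simp add: less_eq_div_iff_mult_less_eq)
      then show ?thesis using pos by auto
    qed
  qed
  then have "card {d. d dvd k} \<le> card ({1..k div m} \<union> (\<lambda>i. k div i) ` {1..m})"
    by (intro card_mono) auto
  also have "\<dots> \<le> card {1..k div m} + card ((\<lambda>i. k div i) ` {1..m})"
    by (rule card_Un_le)
  also have "\<dots> \<le> k div m + m"
    using card_image_le[of "{1..m}" "\<lambda>i. k div i"] by simp
  finally have "real (card {d. d dvd k}) \<le> real (k div m) + real m" by linarith
  also have "real (k div m) \<le> real k / real m" by (rule of_nat_div_le_of_nat)
  finally show ?thesis by simp
qed

text \<open>At least k / 2 of the indices are at least k / 2.\<close>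

lemma sum_powr_ge:
  fixes r :: real
  assumes "r \<ge> 0"
  shows "(\<Sum>i=1..k. real i powr r) \<ge> real k / 2 * (real k / 2) powr r"
proof -
  let ?I = "{i \<in> {1..k}. real k / 2 \<le> real i}"
  have "(\<Sum>i\<in>?I. (real k / 2) powr r) \<le> (\<Sum>i\<in>?I. real i powr r)"
    using assms by (intro sum_mono powr_mono2) auto
  also have "\<dots> \<le> (\<Sum>i=1..k. real i powr r)"
    by (intro sum_mono2) auto
  finally have le: "real (card ?I) * (real k / 2) powr r \<le> (\<Sum>i=1..k. real i powr r)"
    by simp
  have "{k div 2 + 1..k} \<subseteq> ?I" by auto
  then have "card {k div 2 + 1..k} \<le> card ?I" by (intro card_mono) auto
  then have "real k / 2 \<le> real (card ?I)" by simp
  then have "real k / 2 * (real k / 2) powr r \<le> real (card ?I) * (real k / 2) powr r"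
    by (intro mult_right_mono) auto
  then show ?thesis using le by linarith
qed

text \<open>The weights lie between \<open>D1 * k powr r\<close> and \<open>D2 * k powr r\<close>
  times the number of divisors of \<open>k\<close>. Their partial sums grow at least like
  \<open>k powr (r + 1)\<close>, so the o(k) divisor bound makes single weights negligible and
  \<open>log_deriv_ratio\<close> applies.\<close>

lemma (in sized_types) expansive_smooth:
  fixes r y D1 D2 :: real
  assumes r: "r > 0" and y: "y \<ge> 1" and D: "D1 > 0" "D2 > 0"
    and lower: "\<And>j. j \<ge> 1 \<Longrightarrow> D1 * real j powr (r - 1) * y ^ j \<le> real (card {S \<in> C. sz S = j})"
    and upper: "\<And>j. j \<ge> 1 \<Longrightarrow> real (card {S \<in> C. sz S = j}) \<le> D2 * real j powr (r - 1) * y ^ j"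
  shows "\<exists>K. smooth_types C sz (1 / y) K"
proof -
  define H :: "real fps" where "H = Abs_fps (\<lambda>n. real (c n) / y ^ n)"
  define W :: "real fps" where "W = Abs_fps (\<lambda>k. if k = 0 then 0 else real (divisor_weight k) / y ^ k)"
  have ypos: "y > 0" using y by simp
  have Hn: "fps_nth H n = real (c n) / y ^ n" for n by (simp add: H_def)
  have Wn: "fps_nth W k = (if k = 0 then 0 else real (divisor_weight k) / y ^ k)" for k
    by (simp add: W_def)
  have Wnn: "fps_nth W k \<ge> 0" for k using ypos by (simp add: Wn)
  have W_lower: "fps_nth W k \<ge> D1 * real k powr r" if "k \<ge> 1" for k
  proof -
    \<comment> \<open>Only the divisor \<open>k\<close> itself is kept.\<close>
    have "k * card {S \<in> C. sz S = k} \<le> divisor_weight k"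
      unfolding divisor_weight_eq[OF that[unfolded One_nat_def Suc_le_eq]]
      using that by (intro member_le_sum) auto
    then have "real k * real (card {S \<in> C. sz S = k}) \<le> real (divisor_weight k)"
      by (metis of_nat_le_iff of_nat_mult)
    moreover have "real k * (D1 * real k powr (r - 1) * y ^ k) \<le> real k * real (card {S \<in> C. sz S = k})"
      using lower[OF that] by (intro mult_left_mono) auto
    moreover have "real k * (D1 * real k powr (r - 1) * y ^ k) = D1 * real k powr r * y ^ k"
      using that by (simp add: powr_mult_base)
    ultimately have "D1 * real k powr r * y ^ k \<le> real (divisor_weight k)" by linarith
    then show ?thesis using that ypos by (simp add: Wn le_divide_eq)
  qed
  have W_upper: "fps_nth W k \<le> D2 * real k powr r * real (card {d. d dvd k})" if "k \<ge> 1" for k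
  proof -
    have "real (divisor_weight k) = (\<Sum>d | d dvd k. real d * real (card {S \<in> C. sz S = d}))"
      using divisor_weight_eq[of k] that by simp
    also have "\<dots> \<le> (\<Sum>d | d dvd k. D2 * real k powr r * y ^ k)"
    proof (rule sum_mono)
      fix d assume "d \<in> {d. d dvd k}"
      then have d: "d \<ge> 1" "d \<le> k" using that by (auto intro: Suc_leI dvd_imp_le dvd_pos_nat)
      have "real d * real (card {S \<in> C. sz S = d}) \<le> real d * (D2 * real d powr (r - 1) * y ^ d)"
        using upper[OF d(1)] by (intro mult_left_mono) auto
      also have "\<dots> = D2 * real d powr r * y ^ d"
        using d(1) by (simp add: powr_mult_base)
      also have "\<dots> \<le> D2 * real k powr r * y ^ k"
        using d D r y by (intro mult_mono powr_mono2 power_increasing) auto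
      finally show "real d * real (card {S \<in> C. sz S = d}) \<le> D2 * real k powr r * y ^ k" .
    qed
    finally show ?thesis using that ypos by (simp add: Wn divide_le_eq mult_ac)
  qed
  have cpos: "c n > 0" for n
  proof -
    \<comment> \<open>The lower bound at j = 1 yields a component of size 1, and n copies of it form
      a multiset of size n.\<close>
    have "real (card {S \<in> C. sz S = 1}) > 0"
      using lower[of 1] D ypos by (smt (verit) le_refl mult_pos_pos of_nat_1 one_eq_divide_iff powr_one_eq_one power_one_right)
    then obtain S where S: "S \<in> C" "sz S = 1" by (auto simp: card_gt_0_iff)
    have "set_mset (replicate_mset n S) \<subseteq> C"
      using S(1) by (simp add: set_mset_replicate_mset_subset)
    then have "replicate_mset n S \<in> Om n" using S(2) by (simp add: Om_def)
    then show ?thesis unfolding c_def by (auto simp: card_gt_0_iff finite_Om)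
  qed
  have XH: "fps_X * fps_deriv H = W * H"
  proof (rule fps_ext)
    fix n
    have "fps_nth (fps_X * fps_deriv H) n = real n * fps_nth H n" by (cases n) auto
    also have "\<dots> = real (n * c n) / y ^ n" by (simp add: Hn)
    also have "\<dots> = (\<Sum>k=1..n. real (divisor_weight k) * real (c (n - k)) / y ^ n)"
      by (subst c_recurrence) (simp add: sum_divide_distrib)
    also have "\<dots> = (\<Sum>k=1..n. fps_nth W k * fps_nth H (n - k))"
      using ypos by (intro sum.cong refl) (simp add: Wn Hn flip: power_add)
    also have "\<dots> = (\<Sum>k=0..n. fps_nth W k * fps_nth H (n - k))"
      by (rule sum.mono_neutral_left) (auto simp: Wn)
    also have "\<dots> = fps_nth (W * H) n" by (simp add: fps_mult_nth)
    finally show "fps_nth (fps_X * fps_deriv H) n = fps_nth (W * H) n" .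
  qed
  have W1: "\<forall>\<^sub>F k in sequentially. fps_nth W k \<ge> 1"
  proof -
    have "\<forall>\<^sub>F k in sequentially. real k \<ge> (1 / D1) powr (1 / r)"
      using filterlim_real_sequentially by (simp add: filterlim_at_top)
    then have "\<forall>\<^sub>F k in sequentially. real k powr r \<ge> 1 / D1"
    proof eventually_elim
      case (elim k)
      then have "((1 / D1) powr (1 / r)) powr r \<le> real k powr r"
        using r by (intro powr_mono2) auto
      then show ?case using r D by (simp add: powr_powr)
    qed
    then show ?thesis
      using eventually_ge_at_top[of 1]
    proof eventually_elim
      case (elim k)
      then have "1 \<le> D1 * real k powr r" using D by (simp add: divide_le_eq mult.commute)
      then show ?case using W_lower[OF elim(2)] by linarith
    qed
  qed
  have small: "\<forall>\<^sub>F k in sequentially. fps_nth W k \<le> e * (\<Sum>i\<le>k. fps_nth W i)" if e: "e > 0" for e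
  proof -
    \<comment> \<open>Chosen so that \<open>D2 * k powr r * (q * k)\<close> equals
      \<open>e * D1\<close> times the lower bound of \<open>sum_powr_ge\<close>.\<close>
    define q where "q = e * D1 / (D2 * 2 * 2 powr r)"
    have q: "q > 0" using e D by (simp add: q_def)
    obtain m :: nat where m: "2 / q < real m" using reals_Archimedean2 by blast
    then have m0: "m > 0" using q by (metis divide_pos_pos gr0I less_asym of_nat_0 zero_less_numeral)
    have "1 / real m \<le> q / 2"
      using m q m0 by (simp add: divide_less_eq divide_le_eq mult.commute)
    then have mq: "real k / real m \<le> q / 2 * real k" for k
      using mult_right_mono[of "1 / real m" "q / 2" "real k"] by simp
    \<comment> \<open>Beyond this bound both \<open>k / m\<close> and \<open>m\<close> are at most
      \<open>q / 2 * k\<close>, so \<open>k\<close> has at most \<open>q * k\<close>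
      divisors.\<close>
    have "\<forall>\<^sub>F k in sequentially. k \<ge> max 1 (nat \<lceil>real m / (q / 2)\<rceil>)"
      by (rule eventually_ge_at_top)
    then show ?thesis
    proof eventually_elim
      case (elim k)
      then have k: "k \<ge> 1" and "real m / (q / 2) \<le> real k" by linarith+
      then have "real m \<le> q / 2 * real k" using q by (simp add: field_simps)
      then have "real (card {d. d dvd k}) \<le> q * real k"
        using card_divisors_le[OF m0, of k] mq[of k] k by linarith
      then have "fps_nth W k \<le> D2 * real k powr r * (q * real k)"
        using D by (intro order.trans[OF W_upper[OF k]] mult_left_mono) auto
      also have "\<dots> = e * (D1 * (real k / 2 * (real k / 2) powr r))"
        using D by (simp add: q_def powr_divide)
      also have "\<dots> \<le> e * (D1 * (\<Sum>i=1..k. real i powr r))"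
        using e D r by (intro mult_left_mono sum_powr_ge) auto
      also have "\<dots> \<le> e * (\<Sum>i=1..k. fps_nth W i)"
        using e W_lower by (auto simp: sum_distrib_left[of D1] intro!: mult_left_mono sum_mono)
      also have "\<dots> \<le> e * (\<Sum>i\<le>k. fps_nth W i)"
        using e Wnn by (intro mult_left_mono sum_mono2) auto
      finally show ?case .
    qed
  qed
  have H0: "fps_nth H 0 = 1" by (simp add: Hn c_0)
  have Hpos: "fps_nth H n > 0" for n using cpos ypos by (simp add: Hn)
  have W0: "fps_nth W 0 = 0" by (simp add: Wn)
  note ratio = log_deriv_ratio[OF XH H0 Hpos W0 Wnn W1 small]
  obtain K where K: "K > 0" "\<And>m n. m \<le> n \<Longrightarrow> fps_nth H m \<le> K * fps_nth H n"
    using ratio(2) by blast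
  have "smooth_types C sz (1 / y) K"
  proof
    have "(\<lambda>n. (1 / y) * (fps_nth H n / fps_nth H (Suc n))) \<longlonglongrightarrow> (1 / y) * 1"
      by (intro tendsto_mult tendsto_const ratio(1))
    moreover have "(1 / y) * (fps_nth H n / fps_nth H (Suc n)) = real (c n) / real (c (Suc n))" for n
      using ypos by (simp add: Hn)
    ultimately show "(\<lambda>n. real (c n) / real (c (Suc n))) \<longlonglongrightarrow> 1 / y" by simp
    show "real (c m) \<le> K * (1 / y) ^ (n - m) * real (c n)" if "m \<le> n" for m n
    proof -
      have "real (c m) \<le> K * (real (c n) / y ^ n) * y ^ m"
        using K(2)[OF that] ypos by (simp add: Hn divide_le_eq)
      also have "\<dots> = K * (1 / y) ^ (n - m) * real (c n)"
        using ypos that by (simp add: power_diff power_one_over field_simps)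
      finally show ?thesis .
    qed
  qed (use cpos y K in auto)
  then show ?thesis by blast
qed

theorem theorem3:
  fixes ar :: "'r \<Rightarrow> nat"
    and C :: "('r, 'v) rel_struct set"
    and a :: "nat \<Rightarrow> nat"
    and r y D1 D2 :: real
  assumes "component_types ar C a"
    and "r > 0" and "y \<ge> 1" and "D1 > 0" and "D2 > 0"
    and "\<And>j. j \<ge> 1 \<Longrightarrow> D1 * real j powr (r - 1) * y ^ j \<le> real (a j)"
    and "\<And>j. j \<ge> 1 \<Longrightarrow> real (a j) \<le> D2 * real j powr (r - 1) * y ^ j"
  shows "mso_limit_law ar C"
proof -
  define sz :: "('r, 'v) rel_struct \<Rightarrow> nat" where "sz S = card (univ S)" for S
  have level: "finite {S \<in> C. sz S = j}" "card {S \<in> C. sz S = j} = a j" if "j \<ge> 1" for j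
    using assms(1) that by (auto simp: component_types_def sz_def)
  have pos: "sz S > 0" if "S \<in> C" for S
    using assms(1) that
    by (auto simp: component_types_def sz_def finite_struct_def connected_struct_def card_gt_0_iff)
  interpret sized_types C sz
  proof
    \<comment> \<open>The parameters count types of size j \<ge> 1 only; size 0 is excluded because
      connected structures are nonempty.\<close>
    have "{S \<in> C. sz S = 0} = {}" using pos by auto
    then show "finite {S \<in> C. sz S = j}" for j
      using level(1)[of j] by (cases "j = 0") (simp_all del: Collect_empty_eq)
  qed (rule pos)
  obtain K where K: "smooth_types C sz (1 / y) K"
    using expansive_smooth[OF assms(2-5)] assms(6,7) level(2) by auto
  interpret smooth_types C sz "1 / y" K by (rule K)
  have Om: "multisets_of_size C n = Om n" for n
    by (simp add: multisets_of_size_def Om_def weight_def sz_def)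
  show ?thesis
    unfolding mso_limit_law_def
  proof (intro allI impI)
    fix p :: "'r mso" assume "mso_sentence ar p"
    then obtain A :: "nat set" and t g and \<tau> :: "('r, 'v) rel_struct \<Rightarrow> nat"
      where *: "finite A" "stable A t g" "\<And>S. \<tau> S \<in> A"
        and sat: "\<And>M. models (disjoint_union M) p \<longleftrightarrow> g (image_mset \<tau> M)"
      using models_disjoint_union by metis
    show "convergent (\<lambda>n. real (card {M \<in> multisets_of_size C n. models (disjoint_union M) p})
        / real (card (multisets_of_size C n)))"
      using stable_event_convergent[OF *] by (simp add: Om Pr_def c_def sat Int_def)
  qed
qed

end
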